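(* Let $G$ be an optimal minimally $2$-connected graph of order $n \ge 5$. Then $G$ is bipartite with partite sets the set of vertices of degree $2$ and the set of vertices of degree exceeding $2$.
   Context: Graphs are finite and may have multiple edges but no loops; the degree of a vertex counts edges with multiplicity, and the order of a graph is its number of vertices. For distinct vertices $u,v$ of a graph $G$, $\kappa_G(u,v)$ denotes the maximum number of internally disjoint $u$--$v$ paths in $G$ (a set of $u$--$v$ paths is internally disjoint if no two of them share an edge or a vertex other than $u,v$). The average connectivity of a graph $G$ of order $n$ is $\overline{\kappa}(G)=\sum_{\{u,v\}\subseteq V(G)}\kappa_G(u,v)/\binom{n}{2}$. The connectivity $\kappa(G)$ of a non-trivial graph $G$ is the smallest number of vertices whose removal disconnects $G$ or produces the trivial (one-vertex) graph. A graph $G$ is minimally $2$-connected if $\kappa(G)=2$ and $\kappa(G-e)<2$ for every edge $e$ of $G$. A minimally $2$-connected graph $G$ of order $n$ is called optimal if it has maximum average connectivity among all minimally $2$-connected graphs of order $n$. *)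

theory Defs
  imports Complex_Main
begin

text \<open>
  Multigraphs with labelled edges: \<^term>\<open>ends G e\<close> is the set of end vertices of the edge e, and
  parallel edges are distinct labels with the same set of ends.
\<close>

record ('v, 'e) multigraph =
  verts :: "'v set"
  edges :: "'e set"
  ends :: "'e \<Rightarrow> 'v set"

definition finite_loopless :: "('v, 'e) multigraph \<Rightarrow> bool" where
  "finite_loopless G \<longleftrightarrow>
     finite (verts G) \<and> finite (edges G) \<and>
     (\<forall>e\<in>edges G. ends G e \<subseteq> verts G \<and> card (ends G e) = 2)"

definition order :: "('v, 'e) multigraph \<Rightarrow> nat" where
  "order G = card (verts G)"

definition degree :: "('v, 'e) multigraph \<Rightarrow> 'v \<Rightarrow> nat" where
  "degree G v = card {e \<in> edges G. v \<in> ends G e}"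

definition delete_edge :: "('v, 'e) multigraph \<Rightarrow> 'e \<Rightarrow> ('v, 'e) multigraph" where
  "delete_edge G e = G\<lparr>edges := edges G - {e}\<rparr>"

definition delete_verts :: "('v, 'e) multigraph \<Rightarrow> 'v set \<Rightarrow> ('v, 'e) multigraph" where
  "delete_verts G S =
     G\<lparr>verts := verts G - S, edges := {e \<in> edges G. ends G e \<inter> S = {}}\<rparr>"

text \<open>
  A path is the pair of its vertex sequence and its edge sequence. Recording the edges
  distinguishes paths that use different parallel edges.
\<close>

definition path_between ::
  "('v, 'e) multigraph \<Rightarrow> 'v \<Rightarrow> 'v \<Rightarrow> 'v list \<times> 'e list \<Rightarrow> bool" where
  "path_between G u v p \<longleftrightarrow>
     (let vs = fst p; es = snd p in
        length vs = Suc (length es) \<and> distinct vs \<and> hd vs = u \<and> last vs = v \<and>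
        set vs \<subseteq> verts G \<and> set es \<subseteq> edges G \<and>
        (\<forall>i<length es. ends G (es ! i) = {vs ! i, vs ! Suc i}))"

definition internally_disjoint_paths ::
  "('v, 'e) multigraph \<Rightarrow> 'v \<Rightarrow> 'v \<Rightarrow> ('v list \<times> 'e list) set \<Rightarrow> bool" where
  "internally_disjoint_paths G u v P \<longleftrightarrow>
     (\<forall>p\<in>P. path_between G u v p) \<and>
     (\<forall>p\<in>P. \<forall>q\<in>P. p \<noteq> q \<longrightarrow>
        set (snd p) \<inter> set (snd q) = {} \<and> set (fst p) \<inter> set (fst q) \<subseteq> {u, v})"

definition local_connectivity :: "('v, 'e) multigraph \<Rightarrow> 'v \<Rightarrow> 'v \<Rightarrow> nat" where
  "local_connectivity G u v = Max {card P |P. internally_disjoint_paths G u v P}"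

text \<open>
  The local connectivity of an unordered pair of vertices, which is well defined by symmetry;
  see \<open>pair_connectivity_doubleton\<close> below.
\<close>

definition pair_connectivity :: "('v, 'e) multigraph \<Rightarrow> 'v set \<Rightarrow> nat" where
  "pair_connectivity G S = (THE k. \<exists>u v. S = {u, v} \<and> u \<noteq> v \<and> k = local_connectivity G u v)"

definition average_connectivity :: "('v, 'e) multigraph \<Rightarrow> real" where
  "average_connectivity G =
     (\<Sum>S | S \<subseteq> verts G \<and> card S = 2. real (pair_connectivity G S)) / real (order G choose 2)"

definition graph_connected :: "('v, 'e) multigraph \<Rightarrow> bool" where
  "graph_connected G \<longleftrightarrow> (\<forall>u\<in>verts G. \<forall>v\<in>verts G. \<exists>p. path_between G u v p)"

text \<open>Meaningful only for non-empty graphs; the graph without vertices counts as connected.\<close>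

definition connectivity :: "('v, 'e) multigraph \<Rightarrow> nat" where
  "connectivity G = (LEAST k. \<exists>S\<subseteq>verts G. card S = k \<and>
     (\<not> graph_connected (delete_verts G S) \<or> order (delete_verts G S) = 1))"

definition minimally_2_connected :: "('v, 'e) multigraph \<Rightarrow> bool" where
  "minimally_2_connected G \<longleftrightarrow>
     finite_loopless G \<and> order G \<ge> 2 \<and> connectivity G = 2 \<and>
     (\<forall>e\<in>edges G. connectivity (delete_edge G e) < 2)"

text \<open>
  The competitors H range over graphs whose vertices and edges are natural numbers. Every finite
  graph is isomorphic to such a graph, so this is a maximum over all graphs of the given order,
  whatever the types of vertices and edges of G are.
\<close>

definition optimal_minimally_2_connected :: "('v, 'e) multigraph \<Rightarrow> bool" where
  "optimal_minimally_2_connected G \<longleftrightarrow>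
     minimally_2_connected G \<and>
     (\<forall>H :: (nat, nat) multigraph. minimally_2_connected H \<and> order H = order G \<longrightarrow>
        average_connectivity H \<le> average_connectivity G)"

definition bipartite_with_parts :: "('v, 'e) multigraph \<Rightarrow> 'v set \<Rightarrow> 'v set \<Rightarrow> bool" where
  "bipartite_with_parts G A B \<longleftrightarrow>
     A \<union> B = verts G \<and> A \<inter> B = {} \<and>
     (\<forall>e\<in>edges G. \<exists>a\<in>A. \<exists>b\<in>B. ends G e = {a, b})"

lemma path_between_rev:
  assumes "path_between G u v (vs, es)"
  shows "path_between G v u (rev vs, rev es)"
proof -
  have len: "length vs = Suc (length es)"
    and e: "\<And>i. i < length es \<Longrightarrow> ends G (es ! i) = {vs ! i, vs ! Suc i}"
    using assms by (auto simp: path_between_def Let_def)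
  have "ends G (rev es ! i) = {rev vs ! i, rev vs ! Suc i}" if "i < length es" for i
  proof -
    have "Suc (length es - Suc i) = length es - i" using that by simp
    then show ?thesis using e[of "length es - Suc i"] that len by (auto simp: rev_nth)
  qed
  moreover have "vs \<noteq> []" using len by auto
  ultimately show ?thesis
    using assms by (auto simp: path_between_def Let_def hd_rev last_rev)
qed

lemma internally_disjoint_paths_rev:
  assumes "internally_disjoint_paths G u v P"
  shows "internally_disjoint_paths G v u (map_prod rev rev ` P)"
  unfolding internally_disjoint_paths_def
proof (intro conjI ballI impI)
  fix p assume "p \<in> map_prod rev rev ` P"
  then obtain vs es where "(vs, es) \<in> P" "p = (rev vs, rev es)" by auto
  then show "path_between G v u p"
    using assms path_between_rev[of G u v vs es] by (auto simp: internally_disjoint_paths_def)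
next
  fix p q assume "p \<in> map_prod rev rev ` P" "q \<in> map_prod rev rev ` P" "p \<noteq> q"
  then obtain p' q' where pq: "p' \<in> P" "q' \<in> P"
    "p = map_prod rev rev p'" "q = map_prod rev rev q'" by (elim imageE)
  with \<open>p \<noteq> q\<close> have "p' \<noteq> q'" by metis
  then have "set (snd p') \<inter> set (snd q') = {}" "set (fst p') \<inter> set (fst q') \<subseteq> {u, v}"
    using assms pq(1,2) by (simp_all add: internally_disjoint_paths_def)
  then show "set (snd p) \<inter> set (snd q) = {}" "set (fst p) \<inter> set (fst q) \<subseteq> {v, u}"
    by (simp_all add: pq(3,4) insert_commute)
qed

lemma card_rev_paths: "card (map_prod rev rev ` P) = card P"
  by (rule card_image) (auto simp: inj_on_def)

lemma local_connectivity_commute: "local_connectivity G u v = local_connectivity G v u"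
proof -
  have "{card P |P. internally_disjoint_paths G u v P} \<subseteq>
        {card P |P. internally_disjoint_paths G v u P}" for u v
  proof
    fix n assume "n \<in> {card P |P. internally_disjoint_paths G u v P}"
    then obtain P where P: "internally_disjoint_paths G u v P" "n = card P" by blast
    then have "n = card (map_prod rev rev ` P)" by (simp add: card_rev_paths)
    then show "n \<in> {card P |P. internally_disjoint_paths G v u P}"
      using internally_disjoint_paths_rev[OF P(1)] by blast
  qed
  from subset_antisym[OF this[of u v] this[of v u]] show ?thesis
    unfolding local_connectivity_def by (rule arg_cong)
qed

lemma pair_connectivity_doubleton:
  assumes "u \<noteq> v"
  shows "pair_connectivity G {u, v} = local_connectivity G u v"
  unfolding pair_connectivity_def
  using assms local_connectivity_commute[of G u v]
  by (intro the_equality) (auto simp: doubleton_eq_iff)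

lemma finite_card_internally_disjoint_paths:
  assumes "finite_loopless G"
  shows "finite {card P |P. internally_disjoint_paths G u v P}"
proof -
  have fin: "finite (verts G)" "finite (edges G)"
    using assms by (simp_all add: finite_loopless_def)
  define A where "A = {vs. set vs \<subseteq> verts G \<and> length vs \<le> card (verts G)}"
  define B where "B = {es. set es \<subseteq> edges G \<and> length es \<le> card (verts G)}"
  have "finite (A \<times> B)"
    unfolding A_def B_def by (intro finite_cartesian_product finite_lists_length_le fin)
  moreover have "{p. path_between G u v p} \<subseteq> A \<times> B"
  proof
    fix p assume "p \<in> {p. path_between G u v p}"
    then have p: "length (fst p) = Suc (length (snd p))" "distinct (fst p)"
      "set (fst p) \<subseteq> verts G" "set (snd p) \<subseteq> edges G"
      by (simp_all add: path_between_def Let_def)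
    have "length (fst p) \<le> card (verts G)"
      using card_mono[OF fin(1) p(3)] distinct_card[OF p(2)] by simp
    then show "p \<in> A \<times> B"
      using p by (simp add: A_def B_def mem_Times_iff)
  qed
  ultimately have "finite {p. path_between G u v p}"
    by (rule rev_finite_subset)
  then have "finite (card ` Pow {p. path_between G u v p})" by simp
  moreover have "{card P |P. internally_disjoint_paths G u v P} \<subseteq>
                 card ` Pow {p. path_between G u v p}"
    unfolding internally_disjoint_paths_def by blast
  ultimately show ?thesis by (rule rev_finite_subset)
qed

end

(*
  An edge uv of a minimally 2-connected graph G whose two ends both have degree at least 3, or both
  have degree 2, can be traded for a better graph. Since G - uv is not 2-connected, it has a cut
  vertex c that separates u from v, so local connectivities at least 3 only occur within one side
  of c. Hence contracting uv keeps the graph minimally 2-connected (this is where the degrees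
  matter) and preserves every local connectivity of at least 3, so that the total connectivity
  drops by at most 2(n - 1). An optimal graph has two vertices of local connectivity at least 3, as
  it is not worse than K(2, n - 2), and joining a new vertex to the two images of such a pair again
  gives a minimally 2-connected graph of order n; this raises the total by at least 2(n - 1) + 1.
*)

theory Submission
  imports Defs
begin

section \<open>Connectedness inside a vertex set\<close>

text \<open>Only pairs of local connectivity at least 3 need care: the contraction is again
  2-connected, so by Whitney's theorem no pair falls below 2. The loss is counted star by star. The
  pair uv contributes at most 2, and for each of the n - 2 other vertices x the two values at ux and
  vx are replaced by a single one, at a loss of at most 2; together 2 + 2(n - 2) = 2(n - 1). The
  critical vertex is x = c, which may be highly connected to both u and v; there the paths on the
  two sides of the cut have to be added up. The new vertex brings n - 1 pairs of value at least 2,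
  and the pair that it is joined to gains a path: this is the extra 1. Contraction must not identify
  two edges, since this could lose a path; hence triangles are excluded. Disjoint paths are handled
  as disjoint vertex sets that each carry a walk, because contraction and projection to one side of
  the cut preserve walks but not simple paths.\<close>

definition adj_in :: "'a set set \<Rightarrow> 'a set \<Rightarrow> 'a \<Rightarrow> 'a \<Rightarrow> bool" where
  "adj_in E S a b \<longleftrightarrow> {a, b} \<in> E \<and> a \<in> S \<and> b \<in> S"

text \<open>By reflexivity \<open>conn_in E S x x\<close> holds for every \<open>x\<close>, even
  outside \<open>S\<close>; hence the assumption \<open>x \<in> S\<close> in
  \<open>conn_in_mem\<close> and \<open>vpath_exists\<close>.\<close>

abbreviation conn_in :: "'a set set \<Rightarrow> 'a set \<Rightarrow> 'a \<Rightarrow> 'a \<Rightarrow> bool" where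
  "conn_in E S \<equiv> (adj_in E S)\<^sup>*\<^sup>*"

lemma conn_in_mono: "conn_in E S x y \<Longrightarrow> E \<subseteq> E' \<Longrightarrow> S \<subseteq> S' \<Longrightarrow> conn_in E' S' x y"
  by (erule rtranclp_mono[THEN predicate2D, rotated]) (auto simp: adj_in_def)

lemma conn_in_edges:
  assumes "conn_in E S x y" and "\<And>a b. {a, b} \<in> E \<Longrightarrow> a \<in> S \<Longrightarrow> b \<in> S \<Longrightarrow> {a, b} \<in> E'"
  shows "conn_in E' S x y"
  using assms(1) by (rule rtranclp_mono[THEN predicate2D, rotated]) (auto simp: adj_in_def assms(2))

lemma conn_in_verts:
  assumes "conn_in E S x y" and "\<And>a b. {a, b} \<in> E \<Longrightarrow> a \<in> S \<Longrightarrow> b \<in> S \<Longrightarrow> a \<in> S' \<and> b \<in> S'"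
  shows "conn_in E S' x y"
  using assms(1) by (rule rtranclp_mono[THEN predicate2D, rotated]) (auto simp: adj_in_def dest: assms(2))

lemma conn_in_sym: "conn_in E S x y \<Longrightarrow> conn_in E S y x"
proof (induction rule: rtranclp_induct)
  case (step b c)
  then have "adj_in E S c b" by (simp add: adj_in_def insert_commute)
  then show ?case using step.IH by (rule converse_rtranclp_into_rtranclp)
qed simp

lemma conn_in_edge: "{x, y} \<in> E \<Longrightarrow> x \<in> S \<Longrightarrow> y \<in> S \<Longrightarrow> conn_in E S x y"
  by (rule r_into_rtranclp) (simp add: adj_in_def)

lemma conn_in_mem: "conn_in E S x y \<Longrightarrow> x \<in> S \<Longrightarrow> y \<in> S"
  by (induction rule: rtranclp_induct) (auto simp: adj_in_def)

text \<open>An edge may go to any walk: to a trivial one under contraction, or to a detour when the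
  edge has been deleted.\<close>

lemma conn_in_map:
  assumes "conn_in E S x y"
    and "\<And>a b. {a, b} \<in> E \<Longrightarrow> a \<in> S \<Longrightarrow> b \<in> S \<Longrightarrow> conn_in E' S' (f a) (f b)"
  shows "conn_in E' S' (f x) (f y)"
  using assms(1)
proof (induction rule: rtranclp_induct)
  case (step b c)
  then have "conn_in E' S' (f b) (f c)" using assms(2) by (simp add: adj_in_def)
  with step.IH show ?case by (rule rtranclp_trans)
qed simp

text \<open>The contrapositive yields crossing edges: a set that contains \<open>x\<close> but not
  \<open>y\<close> is left by some edge inside \<open>S\<close>.\<close>

lemma conn_in_closed:
  assumes "conn_in E S x y" "x \<in> Z"
    and "\<And>a b. {a, b} \<in> E \<Longrightarrow> a \<in> S \<Longrightarrow> b \<in> S \<Longrightarrow> a \<in> Z \<Longrightarrow> b \<in> Z"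
  shows "y \<in> Z"
  using assms(1,2) by (induction rule: rtranclp_induct) (auto simp: adj_in_def dest: assms(3))

definition vpath :: "'a set set \<Rightarrow> 'a \<Rightarrow> 'a \<Rightarrow> 'a list \<Rightarrow> bool" where
  "vpath E x y vs \<longleftrightarrow> vs \<noteq> [] \<and> hd vs = x \<and> last vs = y \<and> distinct vs \<and>
     successively (\<lambda>a b. {a, b} \<in> E) vs"

lemma vpath_split:
  assumes "vpath E x y (as @ r # bs)"
  shows "vpath E x r (as @ [r])" "vpath E r y (r # bs)"
proof -
  have s: "successively (\<lambda>a b. {a, b} \<in> E) as" "successively (\<lambda>a b. {a, b} \<in> E) (r # bs)"
    "as = [] \<or> {last as, r} \<in> E"
    and h: "hd (as @ r # bs) = x" "last (r # bs) = y" "distinct (as @ r # bs)"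
    using assms unfolding vpath_def successively_append_iff by simp_all
  have "hd (as @ [r]) = x" using h(1) by (cases as) simp_all
  moreover have "successively (\<lambda>a b. {a, b} \<in> E) (as @ [r])"
    unfolding successively_append_iff using s(1,3) by simp
  ultimately show "vpath E x r (as @ [r])" using h(3) by (simp add: vpath_def)
  show "vpath E r y (r # bs)" using s(2) h(2,3) by (simp add: vpath_def)
qed

lemma vpath_exists:
  assumes "conn_in E S x y" "x \<in> S"
  obtains vs where "vpath E x y vs" "set vs \<subseteq> S"
proof -
  have "\<exists>vs. vpath E x y vs \<and> set vs \<subseteq> S"
    using assms
  proof (induction rule: converse_rtranclp_induct)
    case base
    then show ?case by (intro exI[of _ "[y]"]) (auto simp: vpath_def)
  next
    case (step a b)
    have ab: "{a, b} \<in> E" "a \<in> S" "b \<in> S" using step.hyps(1) by (simp_all add: adj_in_def)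
    then obtain vs where vs: "vpath E b y vs" "set vs \<subseteq> S" using step.IH by blast
    show ?case
    proof (cases "a \<in> set vs")
      case True
      then obtain as bs where asbs: "vs = as @ a # bs" by (meson split_list)
      then have "vpath E a y (a # bs)" "set (a # bs) \<subseteq> S"
        using vpath_split(2)[of E b y as a bs] vs by auto
      then show ?thesis by blast
    next
      case False
      have "vpath E a y (a # vs)"
        using vs(1) ab(1) False by (simp add: vpath_def successively_Cons)
      moreover have "set (a # vs) \<subseteq> S" using vs ab by simp
      ultimately show ?thesis by blast
    qed
  qed
  then show ?thesis using that by blast
qed

lemma vpath_conn:
  assumes "vpath E x y vs" "set vs \<subseteq> S"
  shows "conn_in E S x y"
  using assms
proof (induction vs arbitrary: x)
  case Nil
  then show ?case by (simp add: vpath_def)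
next
  case (Cons a vs)
  show ?case
  proof (cases vs)
    case Nil
    then show ?thesis using Cons.prems by (auto simp: vpath_def)
  next
    case (Cons b ws)
    then have "vpath E b y vs" "{x, b} \<in> E" "x \<in> S" "b \<in> S"
      using Cons.prems by (auto simp: vpath_def)
    then show ?thesis
      using Cons.IH[of b] Cons.prems by (auto simp: adj_in_def intro: converse_rtranclp_into_rtranclp)
  qed
qed

text \<open>Cut a simple path at its first vertex in \<open>W\<close>; \<open>R\<close> is the
  vertex set of the piece up to there.\<close>

lemma first_hit:
  assumes "conn_in E S y x" "y \<in> S" "x \<in> W"
  obtains r R where "r \<in> W" "R \<subseteq> S" "R \<inter> W = {r}" "y \<in> R" "conn_in E R y r"
proof -
  obtain vs where vs: "vpath E y x vs" "set vs \<subseteq> S" using vpath_exists assms by metis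
  then have "\<exists>a\<in>set vs. a \<in> W" using assms unfolding vpath_def by (metis last_in_set)
  then obtain as r bs where r: "vs = as @ r # bs" "r \<in> W" "\<forall>a\<in>set as. a \<notin> W"
    using split_list_first_prop[of vs "\<lambda>a. a \<in> W"] by blast
  have p: "vpath E y r (as @ [r])" by (rule vpath_split(1)[of E y x as r bs]) (use vs r in simp)
  show ?thesis
  proof
    show "conn_in E (set (as @ [r])) y r" using p by (rule vpath_conn) simp
    have "hd (as @ [r]) = y" using p unfolding vpath_def by blast
    then show "y \<in> set (as @ [r])" by (metis hd_in_set snoc_eq_iff_butlast)
    show "set (as @ [r]) \<subseteq> S" using vs(2) r(1) by simp
    show "set (as @ [r]) \<inter> W = {r}" using r(2,3) by auto
    show "r \<in> W" by (rule r(2))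
  qed
qed

section \<open>Simple graphs and 2-connectedness\<close>

definition simple_graph :: "'a set \<Rightarrow> 'a set set \<Rightarrow> bool" where
  "simple_graph V E \<longleftrightarrow> finite V \<and> (\<forall>e\<in>E. e \<subseteq> V \<and> card e = 2)"

lemma simple_graphD:
  assumes "simple_graph V E" "{a, b} \<in> E"
  shows "a \<in> V" "b \<in> V" "a \<noteq> b"
proof -
  have "card {a, b} = 2" "{a, b} \<subseteq> V" using assms by (auto simp: simple_graph_def)
  then show "a \<in> V" "b \<in> V" "a \<noteq> b" by auto
qed

lemma simple_graph_edge:
  assumes "simple_graph V E" "e \<in> E"
  obtains a b where "e = {a, b}" "a \<noteq> b" "a \<in> V" "b \<in> V"
proof -
  have "card e = 2" "e \<subseteq> V" using assms by (auto simp: simple_graph_def)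
  then show ?thesis using that by (auto simp: card_2_iff)
qed

lemma simple_graph_finite: "simple_graph V E \<Longrightarrow> finite E"
  by (rule finite_subset[of _ "Pow V"]) (auto simp: simple_graph_def)

text \<open>Only deletions of single vertices are tested. Connectedness of the whole graph follows
  once there are three vertices, see \<open>two_connected_conn\<close>.\<close>

definition two_connected :: "'a set \<Rightarrow> 'a set set \<Rightarrow> bool" where
  "two_connected V E \<longleftrightarrow>
     (\<forall>d\<in>V. \<forall>x\<in>V - {d}. \<forall>y\<in>V - {d}. conn_in E (V - {d}) x y)"

lemma two_connectedD:
  "two_connected V E \<Longrightarrow> d \<in> V \<Longrightarrow> x \<in> V \<Longrightarrow> y \<in> V \<Longrightarrow> x \<noteq> d \<Longrightarrow> y \<noteq> d \<Longrightarrow>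
    conn_in E (V - {d}) x y"
  by (simp add: two_connected_def)

lemma third_vertex:
  assumes "finite V" "card V \<ge> 3"
  obtains z where "z \<in> V" "z \<noteq> x" "z \<noteq> y"
proof -
  have "\<not> V \<subseteq> {x, y}"
  proof
    assume "V \<subseteq> {x, y}"
    then have "card V \<le> card {x, y}" by (intro card_mono) auto
    then show False using assms(2) card_insert_le_m1[of 2 "{y}" x] by simp
  qed
  then show ?thesis using that by blast
qed

lemma fourth_vertex:
  assumes "finite V" "card V \<ge> 4"
  obtains z where "z \<in> V" "z \<noteq> x" "z \<noteq> y" "z \<noteq> w"
proof -
  have "\<not> V \<subseteq> {x, y, w}"
  proof
    assume "V \<subseteq> {x, y, w}"
    then have "card V \<le> card {x, y, w}" by (intro card_mono) auto
    then show False using assms(2) card_length[of "[x, y, w]"] by simp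
  qed
  then show ?thesis using that by blast
qed

lemma two_connected_conn:
  assumes "two_connected V E" "finite V" "card V \<ge> 3" "x \<in> V" "y \<in> V"
  shows "conn_in E V x y"
proof -
  obtain d where "d \<in> V" "d \<noteq> x" "d \<noteq> y" using third_vertex[OF assms(2,3)] by metis
  then show ?thesis using two_connectedD[OF assms(1), of d x y] assms by (auto elim: conn_in_mono)
qed

text \<open>Take the edge by which a walk from \<open>z\<close> to a third vertex, avoiding
  \<open>d\<close>, leaves \<open>z\<close>.\<close>

lemma two_connected_neighbour:
  assumes "two_connected V E" "finite V" "card V \<ge> 3" "z \<in> V" "d \<in> V" "d \<noteq> z"
  obtains b where "{z, b} \<in> E" "b \<noteq> d" "b \<noteq> z"
proof -
  obtain y where y: "y \<in> V" "y \<noteq> z" "y \<noteq> d" using third_vertex[OF assms(2,3)] by metis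
  have "conn_in E (V - {d}) z y" using assms y by (intro two_connectedD) auto
  then have "\<exists>b. {z, b} \<in> E \<and> b \<noteq> d \<and> b \<noteq> z"
    using conn_in_closed[of E "V - {d}" z y "{z}"] y by blast
  then show ?thesis using that by blast
qed

lemma two_connected_crossing:
  assumes "two_connected V E" "d \<in> V" "x \<in> Z" "x \<in> V" "x \<noteq> d" "y \<in> V" "y \<notin> Z" "y \<noteq> d"
  obtains a b where "{a, b} \<in> E" "a \<in> Z" "b \<notin> Z" "b \<noteq> d"
  using conn_in_closed[OF two_connectedD[OF assms(1,2,4,6,5,8)] assms(3)] assms(7) by blast

text \<open>
  Menger-style bookkeeping with vertex sets instead of paths: a link of x and y contains the interior
  of an x-y path other than the edge xy, and linked E x y k says that there are k internally
  disjoint x-y paths, the edge xy being counted separately.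
\<close>

definition link :: "'a set set \<Rightarrow> 'a \<Rightarrow> 'a \<Rightarrow> 'a set \<Rightarrow> bool" where
  "link E x y I \<longleftrightarrow> x \<notin> I \<and> y \<notin> I \<and> conn_in (E - {{x, y}}) (insert x (insert y I)) x y"

definition link_family :: "'a set set \<Rightarrow> 'a \<Rightarrow> 'a \<Rightarrow> 'a set set \<Rightarrow> bool" where
  "link_family E x y F \<longleftrightarrow> finite F \<and> (\<forall>I\<in>F. link E x y I) \<and> pairwise disjnt F"

definition linked :: "'a set set \<Rightarrow> 'a \<Rightarrow> 'a \<Rightarrow> nat \<Rightarrow> bool" where
  "linked E x y k \<longleftrightarrow> (\<exists>F. link_family E x y F \<and> k \<le> card F + of_bool ({x, y} \<in> E))"

lemma linked_mono: "linked E x y k \<Longrightarrow> l \<le> k \<Longrightarrow> linked E x y l"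
  unfolding linked_def using order_trans by blast

lemma linkedI:
  "link_family E x y F \<Longrightarrow> k \<le> card F + of_bool ({x, y} \<in> E) \<Longrightarrow> linked E x y k"
  unfolding linked_def by blast

lemma link_mono: "link E x y I \<Longrightarrow> E \<subseteq> E' \<Longrightarrow> link E' x y I"
  unfolding link_def using conn_in_mono[of "E - {{x, y}}" _ x y "E' - {{x, y}}"] by blast

lemma linked_edge_mono:
  assumes "linked E x y k" "E \<subseteq> E'"
  shows "linked E' x y k"
proof -
  obtain F where "link_family E x y F" "k \<le> card F + of_bool ({x, y} \<in> E)"
    using assms(1) by (auto simp: linked_def)
  moreover have "of_bool ({x, y} \<in> E) \<le> (of_bool ({x, y} \<in> E') :: nat)"
    using assms(2) by auto
  moreover have "link_family E' x y F"
    using calculation(1) assms(2) by (auto simp: link_family_def elim: link_mono)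
  ultimately show ?thesis using linkedI[of E' x y F k] by linarith
qed

lemma link_sym: "link E x y I \<Longrightarrow> link E y x I"
  using conn_in_sym[of "E - {{x, y}}" "insert x (insert y I)" x y]
  by (simp add: link_def insert_commute)

lemma linked_sym: "linked E x y k \<Longrightarrow> linked E y x k"
  using link_sym[of E x y] by (auto simp: linked_def link_family_def insert_commute[of y x])

text \<open>This is the gain from deleting the edge \<open>xy\<close> in \<open>link\<close>:
  disjoint links are distinct sets, so a map that keeps the members of a family disjoint links is
  injective on it.\<close>

lemma link_nonempty:
  assumes "link E x y I" "x \<noteq> y"
  shows "I \<noteq> {}"
proof
  assume "I = {}"
  then have c: "conn_in (E - {{x, y}}) {x, y} x y" using assms by (simp add: link_def)
  have "y \<in> {x}" by (rule conn_in_closed[OF c]) auto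
  then show False using assms(2) by auto
qed

text \<open>The easy half of Menger's theorem: a set that meets every link bounds their number, by
  choosing one common element for each link.\<close>

lemma disjoint_family_transversal:
  assumes "pairwise disjnt F" "finite X" "\<And>I. I \<in> F \<Longrightarrow> I \<inter> X \<noteq> {}"
  shows "finite F \<and> card F \<le> card X"
proof -
  define f where "f I = (SOME x. x \<in> I \<inter> X)" for I
  have f: "f I \<in> I \<inter> X" if "I \<in> F" for I
    unfolding f_def by (rule someI_ex) (use assms(3)[OF that] in blast)
  have "inj_on f F"
  proof (rule inj_onI)
    fix I J assume "I \<in> F" "J \<in> F" "f I = f J"
    then show "I = J" using f[of I] f[of J] pairwiseD[OF assms(1), of I J] disjnt_iff[of I J] by auto
  qed
  moreover have "f ` F \<subseteq> X" using f by auto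
  ultimately show ?thesis using assms(2) by (meson card_inj_on_le finite_subset inj_on_finite)
qed

lemma link_family_image:
  assumes F: "pairwise disjnt F" "finite F" and xy: "x \<noteq> y"
    and l: "\<And>I. I \<in> F \<Longrightarrow> link E x y (\<phi> I)"
    and d: "\<And>I J. I \<in> F \<Longrightarrow> J \<in> F \<Longrightarrow> I \<noteq> J \<Longrightarrow> \<phi> I \<inter> \<phi> J = {}"
  shows "link_family E x y (\<phi> ` F)" "card (\<phi> ` F) = card F"
proof -
  show "link_family E x y (\<phi> ` F)"
    unfolding link_family_def pairwise_def disjnt_def using F(2) l d by blast
  have "inj_on \<phi> F"
    using link_nonempty[OF l xy] d by (intro inj_onI) blast
  then show "card (\<phi> ` F) = card F" by (rule card_image)
qed

lemma link_family_shrink: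
  assumes "link_family E x y F" "x \<noteq> y"
    and "\<And>I. I \<in> F \<Longrightarrow> link E' x' y' (\<phi> I)" "\<And>I. I \<in> F \<Longrightarrow> \<phi> I \<subseteq> I" "x' \<noteq> y'"
  shows "link_family E' x' y' (\<phi> ` F)" "card (\<phi> ` F) = card F"
proof -
  have F: "pairwise disjnt F" "finite F" using assms by (auto simp: link_family_def)
  have d: "\<And>I J. I \<in> F \<Longrightarrow> J \<in> F \<Longrightarrow> I \<noteq> J \<Longrightarrow> \<phi> I \<inter> \<phi> J = {}"
    using F(1) assms(4) unfolding pairwise_def disjnt_def by blast
  show "link_family E' x' y' (\<phi> ` F)" "card (\<phi> ` F) = card F"
    using link_family_image[OF F assms(5,3) d] by auto
qed

section \<open>Whitney's theorem\<close>

text \<open>One connection follows \<open>P\<close> up to \<open>r\<close> and then \<open>R\<close>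
  backwards to \<open>y\<close>; the other follows \<open>Q\<close> to \<open>y'\<close> and takes
  the edge to \<open>y\<close>. They stay apart because \<open>R\<close> meets both paths in
  \<open>r\<close> only and the initial piece of \<open>P\<close> ends before
  \<open>y'\<close>.\<close>

lemma two_disjoint_connections_step:
  assumes P: "vpath E x y' P" and Q: "vpath E x y' Q" and PQ: "set P \<inter> set Q = {x, y'}"
    and e: "{y', y} \<in> E" and R: "r \<in> set P" "R \<inter> (set P \<union> set Q) = {r}" "conn_in E R y r"
    "y \<in> R" "y' \<notin> R"
  shows "\<exists>S T. S \<inter> T = {x, y} \<and> conn_in E S x y \<and> conn_in E T x y"
proof -
  obtain as bs where P_eq: "P = as @ r # bs" using R(1) by (meson split_list)
  have "r \<noteq> y'" using R by blast
  moreover have "last (r # bs) = y'" "distinct (as @ r # bs)"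
    using P unfolding P_eq vpath_def by simp_all
  ultimately have y': "y' \<notin> set (as @ [r])" by (cases "bs = []") (auto dest: last_in_set)
  have vp: "vpath E x r (as @ [r])" using P unfolding P_eq by (rule vpath_split)
  then have "conn_in E (set (as @ [r])) x r" by (rule vpath_conn) simp
  then have "conn_in E (set (as @ [r]) \<union> R) x r" by (rule conn_in_mono) auto
  moreover have "conn_in E (set (as @ [r]) \<union> R) r y"
    by (rule conn_in_mono[OF conn_in_sym[OF R(3)]]) auto
  ultimately have S: "conn_in E (set (as @ [r]) \<union> R) x y" by (rule rtranclp_trans)
  have "conn_in E (set Q) x y'" using Q by (rule vpath_conn) simp
  then have "conn_in E (insert y (set Q)) x y'" by (rule conn_in_mono) auto
  moreover have "conn_in E (insert y (set Q)) y' y" using e PQ by (intro conn_in_edge) auto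
  ultimately have T: "conn_in E (insert y (set Q)) x y" by (rule rtranclp_trans)
  have "x \<in> set (as @ [r])"
    using vp unfolding vpath_def by (metis hd_in_set)
  then have "(set (as @ [r]) \<union> R) \<inter> insert y (set Q) = {x, y}"
    using y' PQ R(2,4) unfolding P_eq by auto
  then show ?thesis using S T by blast
qed

text \<open>Induction along a walk from \<open>x\<close>, moving a pair of connections from one
  vertex of the walk to the next.\<close>

lemma two_disjoint_connections:
  assumes G: "simple_graph V E" "two_connected V E" "card V \<ge> 3" and "x \<in> V" "y \<in> V" "x \<noteq> y"
  shows "\<exists>S T. S \<inter> T = {x, y} \<and> conn_in E S x y \<and> conn_in E T x y"
proof -
  have fin: "finite V" using G by (simp add: simple_graph_def)
  have "conn_in E V x y" using two_connected_conn[OF G(2) fin G(3)] assms by blast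
  then show ?thesis using \<open>x \<noteq> y\<close>
  proof (induction rule: rtranclp_induct)
    case (step y' y)
    have e: "{y', y} \<in> E" "y' \<in> V" "y \<in> V" using step.hyps(2) by (simp_all add: adj_in_def)
    then have ne: "y' \<noteq> y" using simple_graphD(3)[OF G(1)] by blast
    show ?case
    proof (cases "y' = x")
      case True
      \<comment> \<open>The statement allows \<open>S = T = {x, y}\<close>: between adjacent
        vertices the edge may serve twice. This is why \<open>two_connected_linked\<close> treats
        adjacent vertices separately.\<close>
      then have "conn_in E {x, y} x y" using e by (intro conn_in_edge) auto
      then show ?thesis by (intro exI[of _ "{x, y}"]) auto
    next
      case False
      then obtain S T where ST: "S \<inter> T = {x, y'}" "conn_in E S x y'" "conn_in E T x y'"
        using step.IH by blast
      have xST: "x \<in> S" "x \<in> T" using ST by auto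
      obtain P where P: "vpath E x y' P" "set P \<subseteq> S" using vpath_exists[OF ST(2) xST(1)] .
      obtain Q where Q: "vpath E x y' Q" "set Q \<subseteq> T" using vpath_exists[OF ST(3) xST(2)] .
      have ends: "x \<in> set P" "y' \<in> set P" "x \<in> set Q" "y' \<in> set Q"
        using P(1) Q(1) unfolding vpath_def by (metis hd_in_set last_in_set)+
      then have PQ: "set P \<inter> set Q = {x, y'}" using P(2) Q(2) ST(1) by auto
      \<comment> \<open>As \<open>y'\<close> is no cut vertex, \<open>y\<close> reaches
        \<open>x\<close> without it; the first vertex \<open>r\<close> met on \<open>P\<close> or
        \<open>Q\<close> is where the connection is rerouted.\<close>
      have "conn_in E (V - {y'}) y x"
        using e ne False step.prems \<open>x \<in> V\<close> by (intro two_connectedD[OF G(2)]) auto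
      then obtain r R where R: "r \<in> set P \<union> set Q" "R \<subseteq> V - {y'}" "R \<inter> (set P \<union> set Q) = {r}"
        "y \<in> R" "conn_in E R y r"
        using first_hit[of E "V - {y'}" y x "set P \<union> set Q"] e ne ends by blast
      have y': "y' \<notin> R" using R(2) by auto
      show ?thesis
      proof (cases "r \<in> set P")
        case True
        show ?thesis by (rule two_disjoint_connections_step[OF P(1) Q(1) PQ e(1) True R(3,5,4) y'])
      next
        case False
        then have "r \<in> set Q" using R(1) by blast
        moreover have "set Q \<inter> set P = {x, y'}" "R \<inter> (set Q \<union> set P) = {r}" using PQ R(3) by auto
        ultimately show ?thesis
          using two_disjoint_connections_step[OF Q(1) P(1) _ e(1) _ _ R(5,4) y'] by blast
      qed
    qed
  qed simp
qed

text \<open>If \<open>xy\<close> is an edge, it counts once and all other vertices form a single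
  link: a walk from \<open>x\<close> to \<open>t\<close> avoiding \<open>y\<close> and one from
  \<open>t\<close> to \<open>y\<close> avoiding \<open>x\<close> both miss the edge. Otherwise the
  two connections are genuine links, distinct because links are nonempty.\<close>

lemma two_connected_linked:
  assumes G: "simple_graph V E" "two_connected V E" "card V \<ge> 3" and xy: "x \<in> V" "y \<in> V" "x \<noteq> y"
  shows "linked E x y 2"
proof (cases "{x, y} \<in> E")
  case True
  have fin: "finite V" using G by (simp add: simple_graph_def)
  obtain t where t: "t \<in> V" "t \<noteq> x" "t \<noteq> y" using third_vertex[OF fin G(3)] .
  have "conn_in E (V - {y}) x t" using xy t by (intro two_connectedD[OF G(2)]) auto
  then have "conn_in (E - {{x, y}}) (V - {y}) x t"
    by (rule conn_in_edges) (auto simp: doubleton_eq_iff)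
  then have 1: "conn_in (E - {{x, y}}) V x t" by (rule conn_in_mono) auto
  have "conn_in E (V - {x}) t y" using xy t by (intro two_connectedD[OF G(2)]) auto
  then have "conn_in (E - {{x, y}}) (V - {x}) t y"
    by (rule conn_in_edges) (auto simp: doubleton_eq_iff)
  then have "conn_in (E - {{x, y}}) V t y" by (rule conn_in_mono) auto
  with 1 have "conn_in (E - {{x, y}}) V x y" by (rule rtranclp_trans)
  moreover have "insert x (insert y (V - {x, y})) = V" using xy by auto
  ultimately have "link E x y (V - {x, y})" by (simp add: link_def)
  then have "link_family E x y {V - {x, y}}" by (simp add: link_family_def)
  then show ?thesis by (rule linkedI) (use True in simp)
next
  case False
  obtain S T where ST: "S \<inter> T = {x, y}" "conn_in E S x y" "conn_in E T x y"
    using two_disjoint_connections[OF assms] by blast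
  have "insert x (insert y (S - {x, y})) = S" "insert x (insert y (T - {x, y})) = T"
    "E - {{x, y}} = E" using ST False by auto
  then have l: "link E x y (S - {x, y})" "link E x y (T - {x, y})"
    using ST by (simp_all add: link_def)
  then have "S - {x, y} \<noteq> T - {x, y}" using link_nonempty[OF l(1) xy(3)] ST(1) by blast
  moreover have "link_family E x y {S - {x, y}, T - {x, y}}"
    using l ST(1) by (auto simp: link_family_def pairwise_def disjnt_def)
  ultimately show ?thesis using linkedI[of E x y "{S - {x, y}, T - {x, y}}" 2] by simp
qed

section \<open>Paths and links\<close>

text \<open>This forgets multiplicities, which is harmless where \<open>ends G\<close> is injective
  on the edges; \<open>minimally_2_connectedD\<close> provides that.\<close>

abbreviation edge_sets :: "('v, 'e) multigraph \<Rightarrow> 'v set set" where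
  "edge_sets G \<equiv> ends G ` edges G"

lemma finite_loopless_simple_graph: "finite_loopless G \<Longrightarrow> simple_graph (verts G) (edge_sets G)"
  by (auto simp: finite_loopless_def simple_graph_def)

lemma path_between_nth:
  assumes "path_between G u v (vs, es)"
  shows "length vs = Suc (length es)" "vs ! 0 = u" "vs ! length es = v" "distinct vs"
    "set vs \<subseteq> verts G" "set es \<subseteq> edges G"
    "i < length es \<Longrightarrow> ends G (es ! i) = {vs ! i, vs ! Suc i}"
proof -
  show len: "length vs = Suc (length es)" "distinct vs" "set vs \<subseteq> verts G" "set es \<subseteq> edges G"
    "i < length es \<Longrightarrow> ends G (es ! i) = {vs ! i, vs ! Suc i}"
    using assms by (auto simp: path_between_def Let_def)
  have "hd vs = u" "last vs = v" using assms by (auto simp: path_between_def Let_def)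
  moreover have "vs \<noteq> []" using len by auto
  ultimately show "vs ! 0 = u" "vs ! length es = v" using len by (auto simp: hd_conv_nth last_conv_nth)
qed

lemma path_between_conn_in:
  assumes "path_between G u v (vs, es)"
  shows "conn_in (ends G ` set es) (set vs) u v"
proof -
  note p = path_between_nth[OF assms]
  have "conn_in (ends G ` set es) (set vs) u (vs ! i)" if "i \<le> length es" for i
    using that
  proof (induction i)
    case 0
    then show ?case using p(2) by simp
  next
    case (Suc i)
    then have "{vs ! i, vs ! Suc i} \<in> ends G ` set es" using p(7)[of i] by (metis Suc_le_eq imageI nth_mem)
    then have "conn_in (ends G ` set es) (set vs) (vs ! i) (vs ! Suc i)"
      using Suc.prems p(1) by (intro conn_in_edge) auto
    moreover have "conn_in (ends G ` set es) (set vs) u (vs ! i)" using Suc by simp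
    ultimately show ?case by (rule rtranclp_trans[rotated])
  qed
  then show ?thesis using p(3) by force
qed

lemma vpath_path_between:
  assumes "vpath E u v vs" "set vs \<subseteq> verts G" "E \<subseteq> edge_sets G"
  obtains es where "path_between G u v (vs, es)" "ends G ` set es \<subseteq> E"
proof
  define es where
    "es = map (\<lambda>i. inv_into (edges G) (ends G) {vs ! i, vs ! Suc i}) [0..<length vs - 1]"
  have vs: "vs \<noteq> []" "hd vs = u" "last vs = v" "distinct vs"
    using assms(1) unfolding vpath_def by blast+
  have len: "length es = length vs - 1" by (simp add: es_def)
  have e: "{vs ! i, vs ! Suc i} \<in> E" if "i < length es" for i
    using assms(1) that len unfolding vpath_def successively_conv_nth by auto
  have in_edges: "es ! i \<in> edges G" and ends: "ends G (es ! i) = {vs ! i, vs ! Suc i}"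
    if "i < length es" for i
  proof -
    have *: "{vs ! i, vs ! Suc i} \<in> edge_sets G" using e[OF that] assms(3) by blast
    have es_i: "es ! i = inv_into (edges G) (ends G) {vs ! i, vs ! Suc i}"
      using that len by (simp add: es_def)
    show "es ! i \<in> edges G" unfolding es_i using * by (rule inv_into_into)
    show "ends G (es ! i) = {vs ! i, vs ! Suc i}" unfolding es_i using * by (rule f_inv_into_f)
  qed
  have "set es \<subseteq> edges G" using in_edges by (auto simp: in_set_conv_nth)
  then show "path_between G u v (vs, es)"
    using vs len ends assms(2) by (simp add: path_between_def Let_def)
  show "ends G ` set es \<subseteq> E" using e ends by (auto simp: in_set_conv_nth)
qed

text \<open>The vertices of a path are distinct, so an edge with ends \<open>u\<close> and
  \<open>v\<close> on it would join its first to its last vertex and be the whole path.\<close>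

lemma path_link:
  assumes p: "path_between G u v (vs, es)" and "u \<noteq> v" "vs \<noteq> [u, v]"
  shows "link (edge_sets G) u v (set vs - {u, v})"
proof -
  note n = path_between_nth[OF p]
  have ne: "ends G (es ! i) \<noteq> {u, v}" if i: "i < length es" for i
  proof
    assume "ends G (es ! i) = {u, v}"
    then have "{vs ! i, vs ! Suc i} = {vs ! 0, vs ! length es}" using n(2,3,7) i by simp
    then have "i = 0 \<and> Suc i = length es"
      using i n(1,4) by (auto simp: doubleton_eq_iff nth_eq_iff_index_eq)
    then have len: "length es = 1" "length vs = 2" using n(1) by simp_all
    then obtain a b where "vs = [a, b]" by (auto simp: numeral_2_eq_2 length_Suc_conv)
    then show False using n(2,3) len assms(3) by simp
  qed
  have "ends G ` set es \<subseteq> edge_sets G - {{u, v}}"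
    using n(6) ne by (auto simp: in_set_conv_nth)
  then have "conn_in (edge_sets G - {{u, v}}) (set vs) u v"
    by (rule conn_in_mono[OF path_between_conn_in[OF p] _ order_refl])
  moreover have "u \<in> set vs" "v \<in> set vs" using n(1,2,3) by (metis lessI nth_mem zero_less_Suc)+
  then have "insert u (insert v (set vs - {u, v})) = set vs" by auto
  ultimately show ?thesis by (simp add: link_def)
qed

text \<open>Paths with vertex sequence \<open>[u, v]\<close> give no link. By injectivity of
  \<open>ends G\<close> there is at most one of them, and the \<open>of_bool\<close> term of
  \<open>linked\<close> accounts for it.\<close>

lemma linked_if_paths:
  fixes G :: "('v, 'e) multigraph"
  assumes inj: "inj_on (ends G) (edges G)" and "u \<noteq> v" and P: "internally_disjoint_paths G u v P"
    and "finite P"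
  shows "linked (edge_sets G) u v (card P)"
proof -
  define P1 where "P1 = {p\<in>P. fst p \<noteq> [u, v]}"
  define I where "I p = set (fst p) - {u, v}" for p :: "'v list \<times> 'e list"
  have path: "path_between G u v (fst p, snd p)" if "p \<in> P" for p
    using P that by (simp add: internally_disjoint_paths_def)
  have disj: "set (fst p) \<inter> set (fst q) \<subseteq> {u, v}" if "p \<in> P" "q \<in> P" "p \<noteq> q" for p q
    using P that by (simp add: internally_disjoint_paths_def)
  have link: "link (edge_sets G) u v (I p)" if "p \<in> P1" for p
    using that path_link[OF path[of p] assms(2)] by (auto simp: P1_def I_def)
  have I_disj: "I p \<inter> I q = {}" if "p \<in> P1" "q \<in> P1" "p \<noteq> q" for p q
    using disj[of p q] that by (auto simp: P1_def I_def)
  have "inj_on I P1"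
    using link_nonempty[OF link assms(2)] I_disj by (intro inj_onI) blast
  then have card_F: "card (I ` P1) = card P1" by (rule card_image)
  have F: "link_family (edge_sets G) u v (I ` P1)"
    unfolding link_family_def pairwise_def disjnt_def
    using link I_disj assms(4) by (fastforce simp: P1_def)
  have short: "\<exists>e\<in>edges G. snd p = [e] \<and> ends G e = {u, v}" if "p \<in> P - P1" for p
  proof -
    have vs: "fst p = [u, v]" using that by (simp add: P1_def)
    note n = path_between_nth[OF path[of p]]
    have "length (snd p) = 1" using n(1) vs that by simp
    then obtain e where "snd p = [e]" by (auto simp: length_Suc_conv)
    then show ?thesis using n(6) n(7)[of 0] vs that by simp
  qed
  have "p = q" if "p \<in> P - P1" "q \<in> P - P1" for p q
  proof -
    have "snd p = snd q" using short[OF that(1)] short[OF that(2)] inj by (metis inj_onD)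
    then show ?thesis using that by (simp add: P1_def prod_eq_iff)
  qed
  then have "card (P - P1) \<le> Suc 0" using card_le_Suc0_iff_eq[of "P - P1"] \<open>finite P\<close> by simp
  moreover have "{u, v} \<in> edge_sets G" if ne: "P - P1 \<noteq> {}"
  proof -
    obtain p where "p \<in> P - P1" using ne by blast
    from short[OF this] show ?thesis by (metis imageI)
  qed
  then have "{u, v} \<in> edge_sets G \<or> card (P - P1) = 0" by (metis card.empty)
  ultimately have "card (P - P1) \<le> of_bool ({u, v} \<in> edge_sets G)" by auto
  moreover have "card P = card P1 + card (P - P1)"
    using \<open>finite P\<close> by (subst card_Un_disjoint[symmetric]) (auto simp: P1_def intro: arg_cong[where f = card])
  ultimately show ?thesis using linkedI[OF F, of "card P"] card_F by simp
qed

lemma linked_paths: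
  assumes G: "finite_loopless G" and uv: "u \<in> verts G" "v \<in> verts G" "u \<noteq> v"
    and "linked (edge_sets G) u v k"
  obtains P where "internally_disjoint_paths G u v P" "k \<le> card P"
proof -
  let ?E = "edge_sets G"
  obtain F where F: "link_family ?E u v F" "k \<le> card F + of_bool ({u, v} \<in> ?E)"
    using assms(5) by (auto simp: linked_def)
  have link: "link ?E u v I" if "I \<in> F" for I using F that by (simp add: link_family_def)
  have "\<exists>p. path_between G u v p \<and> set (fst p) - {u, v} \<subseteq> I \<and> {u, v} \<notin> ends G ` set (snd p)"
    if I: "I \<in> F" for I
  proof -
    have "conn_in (?E - {{u, v}}) (insert u (insert v I)) u v" using link[OF I] by (simp add: link_def)
    \<comment> \<open>A link may contain elements outside the graph, but no walk visits
      them.\<close>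
    then have c: "conn_in (?E - {{u, v}}) (insert u (insert v I) \<inter> verts G) u v"
    proof (rule conn_in_verts)
      fix a b assume "{a, b} \<in> ?E - {{u, v}}" "a \<in> insert u (insert v I)" "b \<in> insert u (insert v I)"
      then show "a \<in> insert u (insert v I) \<inter> verts G \<and> b \<in> insert u (insert v I) \<inter> verts G"
        using simple_graphD(1,2)[OF finite_loopless_simple_graph[OF G], of a b] by blast
    qed
    obtain vs where vs: "vpath (?E - {{u, v}}) u v vs" "set vs \<subseteq> insert u (insert v I) \<inter> verts G"
      using vpath_exists[OF c] uv by blast
    obtain es where "path_between G u v (vs, es)" "ends G ` set es \<subseteq> ?E - {{u, v}}"
      using vpath_path_between[OF vs(1), of G] vs(2) by blast
    then show ?thesis using vs(2) by (intro exI[of _ "(vs, es)"]) auto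
  qed
  then obtain p where p: "\<And>I. I \<in> F \<Longrightarrow> path_between G u v (p I)"
    "\<And>I. I \<in> F \<Longrightarrow> set (fst (p I)) - {u, v} \<subseteq> I"
    "\<And>I. I \<in> F \<Longrightarrow> {u, v} \<notin> ends G ` set (snd (p I))"
    by metis
  have FD: "I \<inter> J = {}" if "I \<in> F" "J \<in> F" "I \<noteq> J" for I J
    using F(1) that by (auto simp: link_family_def pairwise_def disjnt_def)
  have verts_disj: "set (fst (p I)) \<inter> set (fst (p J)) \<subseteq> {u, v}" if "I \<in> F" "J \<in> F" "I \<noteq> J" for I J
    using FD[OF that] p(2)[OF that(1)] p(2)[OF that(2)] by blast
  have ends_sub: "ends G e \<subseteq> set (fst q)" if "path_between G u v q" "e \<in> set (snd q)" for e q
  proof -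
    obtain i where "i < length (snd q)" "e = snd q ! i" using \<open>e \<in> set (snd q)\<close> by (auto simp: in_set_conv_nth)
    then show ?thesis using path_between_nth[of G u v "fst q" "snd q"] that(1) by auto
  qed
  have card2: "card (ends G e) = 2" if "e \<in> edges G" for e using G that by (simp add: finite_loopless_def)
  \<comment> \<open>A common edge would have both ends in \<open>{u, v}\<close>, hence join
    \<open>u\<close> to \<open>v\<close>, and links exclude such edges.\<close>
  have edges_disj: "set (snd (p I)) \<inter> set (snd (p J)) = {}" if "I \<in> F" "J \<in> F" "I \<noteq> J" for I J
  proof (rule ccontr)
    assume "set (snd (p I)) \<inter> set (snd (p J)) \<noteq> {}"
    then obtain e where e: "e \<in> set (snd (p I))" "e \<in> set (snd (p J))" by blast
    have "ends G e \<subseteq> {u, v}"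
      using ends_sub[OF p(1)[OF that(1)] e(1)] ends_sub[OF p(1)[OF that(2)] e(2)] verts_disj[OF that] by blast
    moreover have "e \<in> edges G" using e(1) path_between_nth(6)[of G u v "fst (p I)" "snd (p I)"] p(1)[OF that(1)] by auto
    ultimately have "ends G e = {u, v}" using card2 uv(3) by (intro card_subset_eq) auto
    then show False using p(3)[OF that(1)] e(1) by (metis imageI)
  qed
  have inner: "fst (p I) \<noteq> [u, v]" if "I \<in> F" for I
  proof
    assume vs: "fst (p I) = [u, v]"
    note n = path_between_nth[of G u v "[u, v]" "snd (p I)"]
    have "path_between G u v ([u, v], snd (p I))" using p(1)[OF that] vs by (metis prod.collapse)
    then have l: "length (snd (p I)) = 1" using n(1) by simp
    then have "ends G (snd (p I) ! 0) = {u, v}" using n(7)[of 0] \<open>path_between G u v _\<close> by simp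
    moreover have "snd (p I) ! 0 \<in> set (snd (p I))" using l by (intro nth_mem) simp
    ultimately show False using p(3)[OF that] by (metis imageI)
  qed
  have inner_ne: "set (fst (p I)) - {u, v} \<noteq> {}" if "I \<in> F" for I
    using link_nonempty[OF path_link[of G u v "fst (p I)" "snd (p I)"] uv(3)] p(1)[OF that] uv(3) inner[OF that]
    by simp
  have "inj_on p F"
  proof (rule inj_onI, rule ccontr)
    fix I J assume IJ: "I \<in> F" "J \<in> F" "p I = p J" "I \<noteq> J"
    then show False using verts_disj[OF IJ(1,2,4)] inner_ne[OF IJ(1)] by auto
  qed
  then have card_pF: "card (p ` F) = card F" by (rule card_image)
  have fin: "finite F" using F(1) by (simp add: link_family_def)
  have pF: "internally_disjoint_paths G u v (p ` F)"
    unfolding internally_disjoint_paths_def using p(1) verts_disj edges_disj by blast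
  show ?thesis
  proof (cases "{u, v} \<in> ?E")
    case False
    then show ?thesis using that[OF pF] F(2) card_pF by simp
  next
    case True
    then obtain e where e: "e \<in> edges G" "ends G e = {u, v}" by auto
    let ?q = "([u, v], [e])"
    have q: "path_between G u v ?q" using e uv by (simp add: path_between_def)
    have q_disj: "set (snd (p I)) \<inter> {e} = {}" if "I \<in> F" for I
      using p(3)[OF that] e(2) by (auto simp: image_iff)
    have "internally_disjoint_paths G u v (insert ?q (p ` F))"
      unfolding internally_disjoint_paths_def
    proof (intro conjI ballI impI)
      fix r assume "r \<in> insert ?q (p ` F)"
      then show "path_between G u v r" using q p(1) by auto
    next
      fix r s assume rs: "r \<in> insert ?q (p ` F)" "s \<in> insert ?q (p ` F)" "r \<noteq> s"
      consider I where "I \<in> F" "r = ?q" "s = p I" | I where "I \<in> F" "r = p I" "s = ?q"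
        | I J where "I \<in> F" "J \<in> F" "I \<noteq> J" "r = p I" "s = p J"
        using rs by blast
      then have "set (snd r) \<inter> set (snd s) = {} \<and> set (fst r) \<inter> set (fst s) \<subseteq> {u, v}"
      proof cases
        case 1
        then show ?thesis using q_disj[of I] by auto
      next
        case 2
        then show ?thesis using q_disj[of I] by auto
      next
        case 3
        then show ?thesis using edges_disj[of I J] verts_disj[of I J] by simp
      qed
      then show "set (snd r) \<inter> set (snd s) = {}" "set (fst r) \<inter> set (fst s) \<subseteq> {u, v}" by blast+
    qed
    moreover have "?q \<notin> p ` F" using inner by (metis fst_conv imageE)
    then have "k \<le> card (insert ?q (p ` F))" using F(2) card_pF fin True by simp
    ultimately show ?thesis by (rule that)
  qed
qed

lemma le_local_connectivity_iff:
  assumes "finite_loopless G" "inj_on (ends G) (edges G)" "u \<in> verts G" "v \<in> verts G" "u \<noteq> v"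
  shows "k \<le> local_connectivity G u v \<longleftrightarrow> linked (edge_sets G) u v k"
proof -
  let ?A = "{card P |P. internally_disjoint_paths G u v P}"
  have "internally_disjoint_paths G u v {}" by (simp add: internally_disjoint_paths_def)
  then have A: "finite ?A" "?A \<noteq> {}"
    using finite_card_internally_disjoint_paths[OF assms(1)] by blast+
  have iff: "k \<le> local_connectivity G u v \<longleftrightarrow> (\<exists>P. internally_disjoint_paths G u v P \<and> k \<le> card P)"
    unfolding local_connectivity_def Max_ge_iff[OF A] by blast
  show ?thesis
  proof
    assume "k \<le> local_connectivity G u v"
    then obtain P where P: "internally_disjoint_paths G u v P" "k \<le> card P" using iff by blast
    show "linked (edge_sets G) u v k"
    proof (cases "finite P")
      case True
      then show ?thesis using linked_mono[OF linked_if_paths[OF assms(2,5) P(1)] P(2)] by simp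
    next
      case False
      \<comment> \<open>An infinite set has \<open>card\<close> 0, so \<open>k = 0\<close> and the
        empty family suffices.\<close>
      then show ?thesis using P(2) by (intro linkedI[of _ _ _ "{}"]) (auto simp: link_family_def)
    qed
  next
    assume "linked (edge_sets G) u v k"
    then show "k \<le> local_connectivity G u v"
      using linked_paths[OF assms(1,3,4,5)] iff by blast
  qed
qed

section \<open>Contracting an edge\<close>

lemma linked_in_verts:
  assumes "simple_graph V E" "linked E x y k" "x \<in> V" "y \<in> V" "x \<noteq> y"
  obtains F where "link_family E x y F" "k \<le> card F + of_bool ({x, y} \<in> E)"
    "\<And>I. I \<in> F \<Longrightarrow> I \<subseteq> V"
proof -
  obtain F where F: "link_family E x y F" "k \<le> card F + of_bool ({x, y} \<in> E)"
    using assms(2) by (auto simp: linked_def)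
  have l: "link E x y (I \<inter> V)" if "I \<in> F" for I
  proof -
    have I: "link E x y I" using F that by (simp add: link_family_def)
    then have "conn_in (E - {{x, y}}) (insert x (insert y I)) x y" by (simp add: link_def)
    then have "conn_in (E - {{x, y}}) (insert x (insert y (I \<inter> V))) x y"
      by (rule conn_in_verts) (use simple_graphD(1,2)[OF assms(1)] in blast)
    then show ?thesis using I by (simp add: link_def)
  qed
  have "link_family E x y ((\<lambda>I. I \<inter> V) ` F)" "card ((\<lambda>I. I \<inter> V) ` F) = card F"
    by (rule link_family_shrink[OF F(1) assms(5) l _ assms(5)]; simp)+
  then show ?thesis using that[of "(\<lambda>I. I \<inter> V) ` F"] F(2) by auto
qed

text \<open>A walk can only leave and re-enter B through c, so its excursions into B can be replaced by c.\<close>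

lemma conn_in_project:
  assumes "conn_in E S x y" "x \<notin> B" "c \<notin> B"
    and cut: "\<And>a b. {a, b} \<in> E \<Longrightarrow> a \<in> S \<Longrightarrow> b \<in> S \<Longrightarrow> a \<notin> B \<Longrightarrow> b \<in> B \<Longrightarrow> a = c"
  shows "conn_in E (S - B) x (if y \<in> B then c else y)"
  using assms(1)
proof (induction rule: rtranclp_induct)
  case base
  then show ?case using assms(2) by simp
next
  case (step a b)
  have ab: "{a, b} \<in> E" "{b, a} \<in> E" "a \<in> S" "b \<in> S"
    using step.hyps(2) by (simp_all add: adj_in_def insert_commute)
  have "conn_in E (S - B) (if a \<in> B then c else a) (if b \<in> B then c else b)"
    using cut[OF ab(1,3,4)] cut[OF ab(2,4,3)] ab by (auto intro: conn_in_edge)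
  with step.IH show ?case by (rule rtranclp_trans)
qed

text \<open>
  The name w of the contracted vertex is kept as a parameter (it will be u or v), so that the
  statements about contraction are symmetric in u and v.
\<close>

definition merge :: "'a \<Rightarrow> 'a \<Rightarrow> 'a \<Rightarrow> 'a \<Rightarrow> 'a" where
  "merge u v w x = (if x = u \<or> x = v then w else x)"

text \<open>Edges are sets of vertices, so \<open>ux\<close> and \<open>vx\<close> become one edge;
  hence the hypotheses below that no \<open>x\<close> is adjacent to both \<open>u\<close> and
  \<open>v\<close>.\<close>

definition contract :: "'a \<Rightarrow> 'a \<Rightarrow> 'a \<Rightarrow> 'a set set \<Rightarrow> 'a set set" where
  "contract u v w E = (\<lambda>e. merge u v w ` e) ` (E - {{u, v}})"

lemma merge_simps [simp]:
  "merge u v w u = w" "merge u v w v = w" "x \<noteq> u \<Longrightarrow> x \<noteq> v \<Longrightarrow> merge u v w x = x"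
  by (auto simp: merge_def)

lemma contract_commute: "contract u v w E = contract v u w E"
  by (simp add: contract_def merge_def insert_commute disj_commute)

lemma contract_edge: "{a, b} \<in> E \<Longrightarrow> {a, b} \<noteq> {u, v} \<Longrightarrow> {merge u v w a, merge u v w b} \<in> contract u v w E"
  unfolding contract_def by (rule image_eqI[of _ _ "{a, b}"]) auto

lemma contract_edgeE:
  assumes "simple_graph V E" "{x, y} \<in> contract u v w E"
  obtains a b where "{a, b} \<in> E" "{a, b} \<noteq> {u, v}" "merge u v w a = x" "merge u v w b = y"
proof -
  obtain e where e: "e \<in> E" "e \<noteq> {u, v}" "{x, y} = merge u v w ` e"
    using assms(2) by (auto simp: contract_def)
  obtain a b where "e = {a, b}" using simple_graph_edge[OF assms(1) e(1)] by metis
  then show ?thesis using e that[of a b] that[of b a] by (auto simp: doubleton_eq_iff insert_commute)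
qed

lemma simple_graph_contract:
  assumes "simple_graph V E" "u \<noteq> v" "u \<in> V"
  shows "simple_graph (V - {v}) (contract u v u E)"
  unfolding simple_graph_def
proof (intro conjI ballI)
  show "finite (V - {v})" using assms by (simp add: simple_graph_def)
  fix e assume "e \<in> contract u v u E"
  then obtain e' where e': "e' \<in> E" "e' \<noteq> {u, v}" "e = merge u v u ` e'" by (auto simp: contract_def)
  obtain a b where ab: "e' = {a, b}" "a \<noteq> b" "a \<in> V" "b \<in> V"
    using simple_graph_edge[OF assms(1) e'(1)] .
  have ne: "merge u v u a \<noteq> merge u v u b"
    using ab(1,2) e'(2) by (auto simp: merge_def split: if_splits)
  then show "card e = 2" using e' ab(1) by simp
  show "e \<subseteq> V - {v}" using e' ab assms by (auto simp: merge_def)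
qed

text \<open>The image of the walk is a walk. It avoids the edge joining the images of
  \<open>p\<close> and \<open>q\<close>, since the only edges that could be mapped to this pair are
  \<open>uv\<close>, which collapses, and \<open>pq\<close>, which links leave out.\<close>

lemma link_contract:
  fixes u v w
  defines "m \<equiv> merge u v w"
  assumes c: "conn_in (E - {{p, q}}) S p q"
    and e: "\<And>a b. {a, b} \<in> E \<Longrightarrow> a \<in> S \<Longrightarrow> b \<in> S \<Longrightarrow> {m a, m b} = {m p, m q} \<Longrightarrow>
      {a, b} = {u, v} \<or> {a, b} = {p, q}"
    and J: "\<And>a. a \<in> S \<Longrightarrow> m a = m p \<or> m a = m q \<or> m a \<in> J" "m p \<notin> J" "m q \<notin> J"
  shows "link (contract u v w E) (m p) (m q) J"
proof -
  have "conn_in (contract u v w E - {{m p, m q}}) (insert (m p) (insert (m q) J)) (m p) (m q)"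
    using c
  proof (rule conn_in_map)
    fix a b assume ab: "{a, b} \<in> E - {{p, q}}" "a \<in> S" "b \<in> S"
    show "conn_in (contract u v w E - {{m p, m q}}) (insert (m p) (insert (m q) J)) (m a) (m b)"
    proof (cases "{a, b} = {u, v}")
      case True
      then have "m a = m b" by (auto simp: m_def merge_def doubleton_eq_iff)
      then show ?thesis by simp
    next
      case False
      then have "{m a, m b} \<in> contract u v w E"
        unfolding m_def using ab(1) by (intro contract_edge) auto
      moreover have "{m a, m b} \<noteq> {m p, m q}" using e[of a b] ab False by blast
      ultimately show ?thesis using J(1)[OF ab(2)] J(1)[OF ab(3)] by (intro conn_in_edge) auto
    qed
  qed
  then show ?thesis using J(2,3) by (simp add: link_def)
qed

lemma at_most_one_contains:
  assumes "link_family E x y F"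
  shows "card F \<le> Suc (card {I \<in> F. z \<notin> I})"
proof -
  have F: "finite F" "pairwise disjnt F" using assms by (simp_all add: link_family_def)
  have "card {I \<in> F. z \<in> I} \<le> card {z}"
    using disjoint_family_transversal[of "{I \<in> F. z \<in> I}" "{z}"] F(2) by (auto simp: pairwise_def)
  moreover have "card F = card {I \<in> F. z \<notin> I} + card {I \<in> F. z \<in> I}"
    using F(1) by (subst card_Un_disjoint[symmetric]) (auto intro: arg_cong[where f = card])
  ultimately show ?thesis by simp
qed

text \<open>If \<open>vx\<close> is an edge, a link through \<open>v\<close> may shrink to the edge
  \<open>wx\<close>. At most one link is lost in this way, and the edge \<open>wx\<close> makes up
  for it, as \<open>ux\<close> is not an edge by \<open>tri\<close>. If \<open>vx\<close> is not an
  edge, every link survives after removing \<open>v\<close> from it.\<close>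

lemma linked_merge:
  assumes w: "w = u \<or> w = v" and x: "x \<noteq> u" "x \<noteq> v" and "u \<noteq> v"
    and tri: "{u, x} \<notin> E \<or> {v, x} \<notin> E" and l: "linked E u x k"
  shows "linked (contract u v w E) w x k"
proof -
  let ?m = "merge u v w" and ?C = "contract u v w E"
  obtain F where F: "link_family E u x F" "k \<le> card F + of_bool ({u, x} \<in> E)"
    using l by (auto simp: linked_def)
  have I: "u \<notin> I" "x \<notin> I" "conn_in (E - {{u, x}}) (insert u (insert x I)) u x" if "I \<in> F" for I
    using F(1) that by (auto simp: link_family_def link_def)
  have wx: "w \<noteq> x" using w x by blast
  have m: "?m u = w" "?m x = x" using x by simp_all
  have edge: "{w, x} \<in> ?C" if "{u, x} \<in> E \<or> {v, x} \<in> E"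
    using that contract_edge[of u x E u v w] contract_edge[of v x E u v w] x \<open>u \<noteq> v\<close>
    by (auto simp: doubleton_eq_iff)
  have pre: "{a, b} = {u, v} \<or> {a, b} = {u, x} \<or> {a, b} = {v, x}" if "{?m a, ?m b} = {w, x}" for a b
    using that wx x w by (auto simp: merge_def doubleton_eq_iff split: if_splits)
  show ?thesis
  proof (cases "{v, x} \<in> E")
    case True
    let ?F = "{I \<in> F. v \<notin> I}"
    have "link ?C w x I" if "I \<in> ?F" for I
    proof -
      have "link ?C (?m u) (?m x) I"
        using I[of I] pre w x that \<open>u \<noteq> v\<close>
        by (intro link_contract[of E u x "insert u (insert x I)"])
          (auto simp: merge_def doubleton_eq_iff split: if_splits)
      then show ?thesis by (simp add: m)
    qed
    then have "link_family ?C w x ?F" using F(1) by (auto simp: link_family_def pairwise_def)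
    moreover have "{u, x} \<notin> E" "{w, x} \<in> ?C" using True tri edge by blast+
    then have "k \<le> card ?F + of_bool ({w, x} \<in> ?C)"
      using at_most_one_contains[OF F(1), of v] F(2) by simp
    ultimately show ?thesis by (rule linkedI)
  next
    case False
    have "link ?C w x (I - {v})" if "I \<in> F" for I
    proof -
      have "link ?C (?m u) (?m x) (I - {v})"
      proof (rule link_contract[OF I(3)[OF that]])
        fix a b assume ab: "{a, b} \<in> E" "{?m a, ?m b} = {?m u, ?m x}"
        then have "{a, b} = {u, v} \<or> {a, b} = {u, x} \<or> {a, b} = {v, x}" by (intro pre) (simp only: m)
        then show "{a, b} = {u, v} \<or> {a, b} = {u, x}" using ab(1) False by metis
      qed (use I[OF that] w x in \<open>auto simp: merge_def\<close>)
      then show ?thesis by (simp add: m)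
    qed
    then have "link_family ?C w x ((\<lambda>I. I - {v}) ` F)" "card ((\<lambda>I. I - {v}) ` F) = card F"
      by (rule link_family_shrink[OF F(1) x(1)[symmetric] _ _ wx]; blast)+
    moreover have "of_bool ({u, x} \<in> E) \<le> (of_bool ({w, x} \<in> ?C) :: nat)" using edge by auto
    ultimately show ?thesis
      using F(2) linkedI[of ?C w x "(\<lambda>I. I - {v}) ` F" k] by linarith
  qed
qed

text \<open>c is a cut vertex of the graph minus the edge uv, with u and v on different sides A and B.\<close>

locale edge_cut =
  fixes V :: "'a set" and E u v c A B
  assumes G: "simple_graph V E" "two_connected V E"
    and V: "V = insert c (A \<union> B)" "c \<notin> A" "c \<notin> B" "A \<inter> B = {}"
    and uv: "u \<in> A" "v \<in> B" "{u, v} \<in> E"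
    and cross: "\<And>a b. a \<in> A \<Longrightarrow> b \<in> B \<Longrightarrow> {a, b} \<in> E \<Longrightarrow> a = u \<and> b = v"
begin

lemma swap: "edge_cut V E v u c B A"
proof
  fix a b assume "a \<in> B" "b \<in> A" "{a, b} \<in> E"
  then show "a = v \<and> b = u" using cross[of b a] by (simp add: insert_commute)
qed (use G V uv in \<open>auto simp: insert_commute\<close>)

lemma distinct: "u \<noteq> v" "u \<noteq> c" "v \<noteq> c" "u \<in> V" "v \<in> V" "c \<in> V" "u \<notin> B" "v \<notin> A"
  using V uv by auto

text \<open>A walk that misses \<open>u\<close> or \<open>v\<close> cannot use the only edge between
  \<open>A\<close> and \<open>B\<close>, so it enters and leaves \<open>B\<close> through
  \<open>c\<close>.\<close>

lemma project:
  assumes "conn_in E' S x y" "E' \<subseteq> E" "x \<notin> B" "y \<notin> B" "u \<notin> S \<or> v \<notin> S"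
  shows "conn_in E' (S - B) x y"
proof -
  have "conn_in E' (S - B) x (if y \<in> B then c else y)"
  proof (rule conn_in_project[OF assms(1,3) V(3)])
    fix a b assume ab: "{a, b} \<in> E'" "a \<in> S" "b \<in> S" "a \<notin> B" "b \<in> B"
    then have "a \<in> V" using simple_graphD(1)[OF G(1), of a b] assms(2) by blast
    then show "a = c" using cross[of a b] ab V assms(2,5) by blast
  qed
  then show ?thesis using assms(4) by simp
qed

text \<open>Without \<open>c\<close>, a link from \<open>A\<close> to \<open>B\<close> has to cross
  along \<open>uv\<close>; and \<open>uv\<close> cannot be \<open>pq\<close>, the edge that links
  leave out.\<close>

lemma link_crossing:
  assumes "link E p q I" "p \<in> A" "q \<in> B" "c \<notin> I"
  shows "u \<in> insert p I \<and> v \<in> insert q I \<and> (u \<noteq> p \<or> v \<noteq> q)"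
proof -
  let ?S = "insert p (insert q I)"
  have conn: "conn_in (E - {{p, q}}) ?S p q" using assms by (simp add: link_def)
  have "\<exists>a b. {a, b} \<in> E - {{p, q}} \<and> a \<in> ?S \<and> b \<in> ?S \<and> a \<in> A \<and> b \<notin> A"
    using conn_in_closed[OF conn assms(2)] assms(3) V(4) by blast
  then obtain a b where ab: "{a, b} \<in> E" "{a, b} \<noteq> {p, q}" "a \<in> ?S" "b \<in> ?S" "a \<in> A" "b \<notin> A"
    by blast
  have "b \<in> V" using simple_graphD(2)[OF G(1) ab(1)] .
  moreover have "b \<noteq> c" using ab(4) assms V by blast
  ultimately have "b \<in> B" using V(1) ab(6) by blast
  then have "a = u" "b = v" using cross[OF ab(5) _ ab(1)] by auto
  then show ?thesis using ab assms V(4) uv by blast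
qed

text \<open>For \<open>pq = uv\<close> every link contains \<open>c\<close>, which leaves one link
  and the edge. Otherwise \<open>pq\<close> is not an edge and all links meet \<open>{c, u}\<close>
  or all meet \<open>{c, v}\<close>, depending on which end differs.\<close>

lemma not_linked_across:
  assumes pq: "p \<in> A" "q \<in> B"
  shows "\<not> linked E p q 3"
proof
  assume "linked E p q 3"
  then obtain F where F: "link_family E p q F" "3 \<le> card F + of_bool ({p, q} \<in> E)"
    by (auto simp: linked_def)
  have I: "link E p q I" if "I \<in> F" for I using F(1) that by (simp add: link_family_def)
  have F': "pairwise disjnt F" using F(1) by (simp add: link_family_def)
  have bound: "card F \<le> card X" if "finite X" "\<And>I. I \<in> F \<Longrightarrow> I \<inter> X \<noteq> {}" for X
    using disjoint_family_transversal[OF F' that] by blast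
  consider "p = u" "q = v" | "p \<noteq> u" | "q \<noteq> v" by blast
  then show False
  proof cases
    case 1
    have "card F \<le> card {c}" using link_crossing[OF I pq] 1 by (intro bound) auto
    moreover have "of_bool ({p, q} \<in> E) \<le> (1 :: nat)" by simp
    ultimately show False using F(2) by simp
  next
    case 2
    have "card F \<le> card {c, u}" using link_crossing[OF I pq] 2 by (intro bound) auto
    moreover have "{p, q} \<notin> E" using cross[OF pq] 2 by blast
    ultimately show False using F(2) card_insert_le_m1[of 2 "{u}" c] by simp
  next
    case 3
    have "card F \<le> card {c, v}" using link_crossing[OF I pq] 3 by (intro bound) auto
    moreover have "{p, q} \<notin> E" using cross[OF pq] 3 by blast
    ultimately show False using F(2) card_insert_le_m1[of 2 "{v}" c] by simp
  qed
qed

lemma linked_same_side: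
  assumes w: "w = u \<or> w = v" and pq: "p \<in> insert c A - {u}" "q \<in> insert c A - {u}" "p \<noteq> q"
    and l: "linked E p q k"
  shows "linked (contract u v w E) p q k"
proof -
  let ?m = "merge u v w" and ?C = "contract u v w E"
  obtain F where F: "link_family E p q F" "k \<le> card F + of_bool ({p, q} \<in> E)"
    using l by (auto simp: linked_def)
  have I: "p \<notin> I" "q \<notin> I" "conn_in (E - {{p, q}}) (insert p (insert q I)) p q" if "I \<in> F" for I
    using F(1) that by (auto simp: link_family_def link_def)
  have out: "p \<noteq> u" "p \<noteq> v" "q \<noteq> u" "q \<noteq> v" "p \<notin> B" "q \<notin> B" using pq V uv by auto
  have wpq: "w \<noteq> p" "w \<noteq> q" using w out by auto
  have m: "?m p = p" "?m q = q" using out by simp_all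
  have pre: "{a, b} = {p, q}" if "{?m a, ?m b} = {p, q}" for a b
    using that out wpq by (auto simp: merge_def doubleton_eq_iff split: if_splits)
  define \<phi> where "\<phi> I = (if u \<in> I then ?m ` I else I - B)" for I
  have link: "link ?C p q (\<phi> I)" if "I \<in> F" for I
  proof (cases "u \<in> I")
    case True
    have "link ?C (?m p) (?m q) (?m ` I)"
    proof (rule link_contract[OF I(3)[OF that]]; unfold m)
      show "{a, b} = {u, v} \<or> {a, b} = {p, q}" if "{?m a, ?m b} = {p, q}" for a b
        using pre[OF that] by blast
      show "?m a = p \<or> ?m a = q \<or> ?m a \<in> ?m ` I" if "a \<in> insert p (insert q I)" for a
        using that m by auto
      show "p \<notin> ?m ` I" "q \<notin> ?m ` I"
        using I(1,2)[OF that] wpq by (auto simp: merge_def split: if_splits)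
    qed
    then show ?thesis using True by (simp add: m \<phi>_def)
  next
    case False
    then have "conn_in (E - {{p, q}}) (insert p (insert q I) - B) p q"
      using I[OF that] out by (intro project) auto
    then have "link ?C (?m p) (?m q) (I - B)"
    proof (rule link_contract; unfold m)
      show "{a, b} = {u, v} \<or> {a, b} = {p, q}" if "{?m a, ?m b} = {p, q}" for a b
        using pre[OF that] by blast
      show "?m a = p \<or> ?m a = q \<or> ?m a \<in> I - B" if "a \<in> insert p (insert q I) - B" for a
        using that False out uv(2) by (auto simp: merge_def)
      show "p \<notin> I - B" "q \<notin> I - B" using I(1,2)[OF that] by auto
    qed
    then show ?thesis using False by (simp add: m \<phi>_def)
  qed
  have FD: "I \<inter> J = {}" if "I \<in> F" "J \<in> F" "I \<noteq> J" for I J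
    using F(1) that by (auto simp: link_family_def pairwise_def disjnt_def)
  have \<phi>_disj: "\<phi> I \<inter> \<phi> J = {}" if "I \<in> F" "J \<in> F" "I \<noteq> J" for I J
    using FD[OF that] w uv(2) unfolding \<phi>_def by (auto simp: merge_def split: if_splits)
  have "pairwise disjnt F" "finite F" using F(1) by (auto simp: link_family_def)
  then have "link_family ?C p q (\<phi> ` F)" "card (\<phi> ` F) = card F"
    using link_family_image[OF _ _ pq(3) link \<phi>_disj] by auto
  moreover have "{p, q} \<in> ?C" if "{p, q} \<in> E"
    using contract_edge[OF that, of u v w] out by (auto simp: doubleton_eq_iff)
  then have "of_bool ({p, q} \<in> E) \<le> (of_bool ({p, q} \<in> ?C) :: nat)" by auto
  ultimately show ?thesis
    using F(2) linkedI[of ?C p q "\<phi> ` F" k] by linarith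
qed

text \<open>The summand 1 pays for the link through \<open>v\<close>, if there is one. The others do
  not use \<open>uv\<close> and project into \<open>A\<close>.\<close>

lemma merge_cut_half:
  assumes w: "w = u \<or> w = v" and l: "linked E u c k"
  obtains F where "link_family (contract u v w E) w c F" "\<And>I. I \<in> F \<Longrightarrow> I \<subseteq> A"
    "k \<le> card F + 1 + of_bool ({u, c} \<in> E)"
proof -
  let ?m = "merge u v w" and ?C = "contract u v w E"
  obtain F where F: "link_family E u c F" "k \<le> card F + of_bool ({u, c} \<in> E)"
    "\<And>I. I \<in> F \<Longrightarrow> I \<subseteq> V"
    using linked_in_verts[OF G(1) l] distinct by metis
  have I: "u \<notin> I" "c \<notin> I" "conn_in (E - {{u, c}}) (insert u (insert c I)) u c" if "I \<in> F" for I
    using F(1) that by (auto simp: link_family_def link_def)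
  let ?F = "{I \<in> F. v \<notin> I}"
  have m: "?m u = w" "?m c = c" using distinct by simp_all
  have wc: "w \<noteq> c" using w distinct by blast
  have link: "link ?C w c (I - B)" if "I \<in> ?F" for I
  proof -
    have "conn_in (E - {{u, c}}) (insert u (insert c I) - B) u c"
      using I[of I] that distinct V(3) by (intro project) auto
    then have "link ?C (?m u) (?m c) (I - B)"
    proof (rule link_contract; unfold m)
      fix a b assume ab: "a \<in> insert u (insert c I) - B" "b \<in> insert u (insert c I) - B"
        and eq: "{?m a, ?m b} = {w, c}"
      have "a \<noteq> v" "b \<noteq> v" using ab uv(2) by auto
      then show "{a, b} = {u, v} \<or> {a, b} = {u, c}"
        using eq wc distinct w by (auto simp: merge_def doubleton_eq_iff split: if_splits)
    next
      fix a assume "a \<in> insert u (insert c I) - B"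
      then show "?m a = w \<or> ?m a = c \<or> ?m a \<in> I - B" by (auto simp: merge_def)
    next
      show "w \<notin> I - B" "c \<notin> I - B" using I(1,2)[of I] that w uv(2) by auto
    qed
    then show ?thesis by (simp add: m)
  qed
  have sub: "link_family E u c ?F" using F(1) by (auto simp: link_family_def pairwise_def)
  have "link_family ?C w c ((\<lambda>I. I - B) ` ?F)" "card ((\<lambda>I. I - B) ` ?F) = card ?F"
    by (rule link_family_shrink[OF sub distinct(2) link _ wc]; blast)+
  moreover have "J \<subseteq> A" if "J \<in> (\<lambda>I. I - B) ` ?F" for J
    using that F(3) I(2) V(1) by blast
  ultimately show ?thesis
    using that[of "(\<lambda>I. I - B) ` ?F"] F(2) at_most_one_contains[OF F(1), of v] by simp
qed

text \<open>The links from \<open>u\<close> inside \<open>A\<close> and those from \<open>v\<close>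
  inside \<open>B\<close> are disjoint and all become links between \<open>w\<close> and
  \<open>c\<close>. Each side loses at most one, which gives the 2; by \<open>tri\<close> the edge
  \<open>wc\<close> stands for at most one old edge.\<close>

lemma linked_merge_cut:
  assumes w: "w = u \<or> w = v" and "linked E u c k" "linked E v c l"
    and tri: "{u, c} \<notin> E \<or> {v, c} \<notin> E"
  shows "linked (contract u v w E) w c (k + l - 2)"
proof -
  let ?C = "contract u v w E"
  interpret s: edge_cut V E v u c B A by (rule swap)
  obtain F1 where F1: "link_family ?C w c F1" "\<And>I. I \<in> F1 \<Longrightarrow> I \<subseteq> A"
    "k \<le> card F1 + 1 + of_bool ({u, c} \<in> E)"
    using merge_cut_half[OF w assms(2)] by metis
  obtain F2 where F2: "link_family ?C w c F2" "\<And>I. I \<in> F2 \<Longrightarrow> I \<subseteq> B"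
    "l \<le> card F2 + 1 + of_bool ({v, c} \<in> E)"
    using s.merge_cut_half[of w l] w assms(3) contract_commute[of u v w E] by metis
  have wc: "w \<noteq> c" using w distinct by blast
  have disj: "I \<inter> J = {}" if "I \<in> F1" "J \<in> F2" for I J using F1(2)[OF that(1)] F2(2)[OF that(2)] V(4) by blast
  have ne: "I \<noteq> {}" if "I \<in> F1" for I using F1(1) that link_nonempty[OF _ wc] by (auto simp: link_family_def)
  have F12: "F1 \<inter> F2 = {}" using disj ne by blast
  have "link_family ?C w c (F1 \<union> F2)"
    unfolding link_family_def
  proof (intro conjI)
    show "finite (F1 \<union> F2)" "\<forall>I\<in>F1 \<union> F2. link ?C w c I" using F1(1) F2(1) by (auto simp: link_family_def)
    show "pairwise disjnt (F1 \<union> F2)"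
    proof (rule pairwiseI)
      fix I J assume IJ: "I \<in> F1 \<union> F2" "J \<in> F1 \<union> F2" "I \<noteq> J"
      have p: "pairwise disjnt F1" "pairwise disjnt F2"
        using F1(1) F2(1) by (simp_all add: link_family_def)
      show "disjnt I J"
        using IJ disj[of I J] disj[of J I] pairwiseD[OF p(1), of I J] pairwiseD[OF p(2), of I J]
        by (auto simp: disjnt_def)
    qed
  qed
  moreover have "card (F1 \<union> F2) = card F1 + card F2"
    using F1(1) F2(1) F12 by (intro card_Un_disjoint) (auto simp: link_family_def)
  moreover have "{w, c} \<in> ?C" if "{u, c} \<in> E \<or> {v, c} \<in> E"
    using that contract_edge[of u c E u v w] contract_edge[of v c E u v w] distinct
    by (auto simp: doubleton_eq_iff)
  then have "of_bool ({u, c} \<in> E) + of_bool ({v, c} \<in> E) \<le> (of_bool ({w, c} \<in> ?C) :: nat)"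
    using tri by auto
  ultimately show ?thesis
    using F1(3) F2(3) linkedI[of ?C w c "F1 \<union> F2" "k + l - 2"] by linarith
qed

text \<open>This makes the merged vertex harmless: deleting it deletes both \<open>u\<close> and
  \<open>v\<close>, and every other vertex still reaches \<open>c\<close> on its own side.\<close>

lemma conn_to_cut:
  assumes "x \<in> A" "x \<noteq> u"
  shows "conn_in E (V - {u, v}) x c"
proof -
  have "conn_in E (V - {u}) x c"
    using assms distinct V by (intro two_connectedD[OF G(2)]) auto
  then have "conn_in E (V - {u} - B) x c"
    by (rule project) (use assms V in auto)
  then show ?thesis by (rule conn_in_mono) (use uv in auto)
qed

text \<open>Deleting a vertex other than the merged one is handled by mapping a walk of the old
  graph; deleting the merged vertex leaves everything connected through \<open>c\<close>.\<close>

lemma two_connected_contract: "two_connected (V - {v}) (contract u v u E)"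
  unfolding two_connected_def
proof (intro ballI)
  interpret s: edge_cut V E v u c B A by (rule swap)
  let ?m = "merge u v u"
  fix d x y assume d: "d \<in> V - {v}" "x \<in> V - {v} - {d}" "y \<in> V - {v} - {d}"
  have m: "?m x = x" "?m y = y" using d by (auto simp: merge_def)
  have edge: "conn_in (contract u v u E) S' (?m a) (?m b)"
    if "{a, b} \<in> E" "?m a \<in> S'" "?m b \<in> S'" for a b S'
  proof (cases "{a, b} = {u, v}")
    case True
    then have "?m a = ?m b" by (auto simp: merge_def doubleton_eq_iff)
    then show ?thesis by simp
  next
    case False
    then show ?thesis using contract_edge[OF that(1) False, of u] that by (intro conn_in_edge) auto
  qed
  obtain S where S: "conn_in E S x y" "?m ` S \<subseteq> V - {v} - {d}"
  proof (cases "d = u")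
    case False
    have "conn_in E (V - {d}) x y" using d by (intro two_connectedD[OF G(2)]) auto
    moreover have "?m ` (V - {d}) \<subseteq> V - {v} - {d}" using False d distinct by (auto simp: merge_def)
    ultimately show ?thesis by (rule that)
  next
    case True
    have "conn_in E (V - {u, v}) z c" if "z \<in> V - {u, v}" for z
      using conn_to_cut[of z] s.conn_to_cut[of z] that V(1) by (auto simp: insert_commute)
    then have "conn_in E (V - {u, v}) x c" "conn_in E (V - {u, v}) c y"
      using d True conn_in_sym[of E "V - {u, v}" y c] by auto
    then have "conn_in E (V - {u, v}) x y" by (rule rtranclp_trans)
    moreover have "?m ` (V - {u, v}) \<subseteq> V - {v} - {d}" using True d distinct by (auto simp: merge_def)
    ultimately show ?thesis by (rule that)
  qed
  have "conn_in (contract u v u E) (V - {v} - {d}) (?m x) (?m y)"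
    using S(1) by (rule conn_in_map) (use S(2) edge in blast)
  then show "conn_in (contract u v u E) (V - {v} - {d}) x y" by (simp add: m)
qed

end

section \<open>Minimally 2-connected simple graphs\<close>

lemma pendant_not_two_connected:
  assumes "finite V" "card V \<ge> 3" "z \<in> V" "d \<in> V" "d \<noteq> z" "\<And>b. {z, b} \<in> E \<Longrightarrow> b \<noteq> z \<Longrightarrow> b = d"
  shows "\<not> two_connected V E"
  using two_connected_neighbour[of V E z d] assms by metis

definition min_two_connected :: "'a set \<Rightarrow> 'a set set \<Rightarrow> bool" where
  "min_two_connected V E \<longleftrightarrow>
     simple_graph V E \<and> two_connected V E \<and> (\<forall>e\<in>E. \<not> two_connected V (E - {e}))"

text \<open>Some \<open>c\<close> separates two vertices once \<open>uv\<close> is deleted. It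
  separates \<open>u\<close> from \<open>v\<close>, since a walk between them could replace the
  edge. \<open>A\<close> is then the component of \<open>u\<close>, and \<open>B\<close> is the
  rest.\<close>

lemma edge_cut_exists:
  assumes G: "simple_graph V E" "two_connected V E" and uv: "{u, v} \<in> E"
    and "\<not> two_connected V (E - {{u, v}})"
  obtains c A B where "edge_cut V E u v c A B"
proof -
  let ?E = "E - {{u, v}}"
  obtain c x y where c: "c \<in> V" "x \<in> V - {c}" "y \<in> V - {c}" "\<not> conn_in ?E (V - {c}) x y"
    using assms(4) by (auto simp: two_connected_def)
  have xy: "conn_in E (V - {c}) x y" using c by (intro two_connectedD[OF G(2)]) auto
  have V: "u \<in> V" "v \<in> V" "u \<noteq> v" using simple_graphD[OF G(1) uv] .
  have nuv: "\<not> conn_in ?E (V - {c}) u v"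
  proof
    assume uv': "conn_in ?E (V - {c}) u v"
    have "conn_in ?E (V - {c}) x y"
      using xy
    proof (rule conn_in_map[where f = "\<lambda>a. a"])
      fix a b assume ab: "{a, b} \<in> E" "a \<in> V - {c}" "b \<in> V - {c}"
      show "conn_in ?E (V - {c}) a b"
      proof (cases "{a, b} = {u, v}")
        case True
        then show ?thesis using uv' conn_in_sym[OF uv'] by (auto simp: doubleton_eq_iff)
      next
        case False
        then show ?thesis using ab by (intro conn_in_edge) auto
      qed
    qed
    then show False using c(4) by blast
  qed
  \<comment> \<open>If \<open>c\<close> were an end of \<open>uv\<close>, the walk \<open>xy\<close>
    avoiding \<open>c\<close> would not use this edge and would survive its deletion.\<close>
  have ne: "u \<noteq> c" "v \<noteq> c"
  proof -
    have "{a, b} \<noteq> {u, v}" if "a \<in> V - {c}" "b \<in> V - {c}" "u = c \<or> v = c" for a b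
      using that by (auto simp: doubleton_eq_iff)
    then have "conn_in ?E (V - {c}) x y" if "u = c \<or> v = c"
      using xy that by (auto elim!: conn_in_edges)
    then show "u \<noteq> c" "v \<noteq> c" using c(4) by auto
  qed
  define A where "A = {a. conn_in ?E (V - {c}) u a}"
  define B where "B = V - {c} - A"
  have A_sub: "A \<subseteq> V - {c}"
  proof
    fix a assume "a \<in> A"
    then have "conn_in ?E (V - {c}) u a" by (simp add: A_def)
    then show "a \<in> V - {c}" by (rule conn_in_mem) (use V ne in simp)
  qed
  have vA: "v \<notin> A" using nuv by (simp add: A_def)
  have uA: "u \<in> A" by (simp add: A_def)
  have cross: "a = u \<and> b = v" if "a \<in> A" "b \<in> B" "{a, b} \<in> E" for a b
  proof (cases "{a, b} = {u, v}")
    case True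
    then show ?thesis using that vA by (auto simp: doubleton_eq_iff)
  next
    case False
    have "conn_in ?E (V - {c}) a b"
      using that False A_sub by (intro conn_in_edge) (auto simp: B_def)
    then have "conn_in ?E (V - {c}) u b"
      using that(1) unfolding A_def by (auto intro: rtranclp_trans)
    then show ?thesis using that(2) by (simp add: A_def B_def)
  qed
  have "edge_cut V E u v c A B"
  proof
    show "V = insert c (A \<union> B)" using c(1) A_sub by (auto simp: B_def)
    show "c \<notin> A" "c \<notin> B" "A \<inter> B = {}" "v \<in> B" using A_sub V ne vA by (auto simp: B_def)
    show "a = u \<and> b = v" if "a \<in> A" "b \<in> B" "{a, b} \<in> E" for a b using cross[OF that] .
  qed (use G uv uA in auto)
  then show ?thesis by (rule that)
qed

text \<open>The edge \<open>uc\<close> has a cut vertex too, and it must be \<open>v\<close>, which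
  is adjacent to both ends. A further vertex of \<open>A\<close> lies on the side of
  \<open>u\<close> or of \<open>c\<close> in this second cut. The part of \<open>A\<close> on that
  side, without \<open>u\<close>, has only \<open>u\<close>, respectively \<open>c\<close>, as
  outside neighbour, and this would be a cut vertex of the graph.\<close>

lemma (in edge_cut) triangle_side:
  assumes e: "{u, c} \<in> E" "{v, c} \<in> E" and min: "\<not> two_connected V (E - {{u, c}})"
  shows "A = {u}"
proof (rule ccontr)
  assume "A \<noteq> {u}"
  then obtain y where y: "y \<in> A" "y \<noteq> u" using uv by blast
  obtain d A' B' where "edge_cut V E u c d A' B'"
    using edge_cut_exists[OF G e(1) min] .
  then interpret t: edge_cut V E u c d A' B' .
  have "v \<notin> A'" using t.cross[of v c] e(2) t.uv(2) distinct by blast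
  moreover have "v \<notin> B'" using t.cross[of u v] uv(3) t.uv(1) distinct by blast
  ultimately have d: "d = v" using t.V(1) distinct by blast
  have yV: "y \<in> V" "y \<noteq> c" using y V by auto
  have side: "b \<in> A \<or> b \<in> B \<or> b = c" "b \<in> A' \<or> b \<in> B' \<or> b = v" if "b \<in> V" for b
    using that V(1) t.V(1) d by auto
  have "y \<in> A' \<or> y \<in> B'" using side[of y] yV y distinct by blast
  then show False
  proof
    assume "y \<in> A'"
    then obtain a b where ab: "{a, b} \<in> E" "a \<in> A \<inter> A' - {u}" "b \<notin> A \<inter> A' - {u}" "b \<noteq> u"
      using two_connected_crossing[OF G(2), of u y "A \<inter> A' - {u}" c] y yV V distinct by blast
    have "b \<in> V" using simple_graphD(2)[OF G(1) ab(1)] .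
    moreover have "b \<notin> B" "b \<notin> B'" using cross[of a b] t.cross[of a b] ab by blast+
    ultimately have "b \<in> A" "b \<in> A'" using side[of b] t.uv(2) uv(2) by blast+
    then show False using ab by blast
  next
    assume "y \<in> B'"
    then obtain a b where ab: "{a, b} \<in> E" "a \<in> A \<inter> B'" "b \<notin> A \<inter> B'" "b \<noteq> c"
      using two_connected_crossing[OF G(2), of c y "A \<inter> B'" u] y yV V distinct t.distinct by blast
    have "b \<in> V" using simple_graphD(2)[OF G(1) ab(1)] .
    moreover have "b \<notin> B" using cross[of a b] ab t.distinct by blast
    moreover have "b \<notin> A'"
      using t.cross[of b a] ab V by (auto simp: insert_commute)
    ultimately have "b \<in> A" "b \<in> B'" using side[of b] ab(4) uv(2) by blast+
    then show False using ab by blast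
  qed
qed

text \<open>A common neighbour of \<open>u\<close> and \<open>v\<close> lies on neither side of the
  cut, so it is \<open>c\<close>. Then both sides are single vertices and the graph has only
  three.\<close>

lemma min_two_connected_triangle_free:
  assumes G: "min_two_connected V E" and "card V \<ge> 4" and e: "{u, v} \<in> E" "{u, x} \<in> E" "{v, x} \<in> E"
  shows False
proof -
  have G': "simple_graph V E" "two_connected V E" "\<And>e. e \<in> E \<Longrightarrow> \<not> two_connected V (E - {e})"
    using G by (auto simp: min_two_connected_def)
  obtain c A B where cut: "edge_cut V E u v c A B"
    using edge_cut_exists[OF G'(1,2) e(1) G'(3)[OF e(1)]] .
  interpret edge_cut V E u v c A B by (rule cut)
  interpret s: edge_cut V E v u c B A by (rule swap)
  have x: "x \<in> V" "u \<noteq> x" "v \<noteq> x" using simple_graphD[OF G'(1) e(2)] simple_graphD[OF G'(1) e(3)] by auto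
  have "x \<notin> A" using cross[of x v] e(3) uv x by (auto simp: insert_commute)
  moreover have "x \<notin> B" using cross[of u x] e(2) uv x by auto
  ultimately have xc: "x = c" using x V(1) by blast
  have "A = {u}" using triangle_side e G'(3) xc by blast
  moreover have "B = {v}" using s.triangle_side e G'(3) xc by blast
  ultimately have "V \<subseteq> {c, u, v}" using V(1) by auto
  then have "card V \<le> card {c, u, v}" by (rule card_mono[rotated]) simp
  then show False using card_length[of "[c, u, v]"] assms(2) by simp
qed

text \<open>Walks of the contraction lift, with \<open>uv\<close> inserted where needed. The
  obstacle is deleting \<open>u\<close> or \<open>v\<close>: the contraction loses the merged
  vertex, while the other end remains and must be attached by a further edge. This is what
  \<open>t1\<close> and \<open>t2\<close> are for.\<close>

lemma (in edge_cut) two_connected_uncontract: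
  assumes e: "e \<noteq> {u, v}" and t: "{v, t1} \<in> E - {e}" "t1 \<noteq> u" "{u, t2} \<in> E - {e}" "t2 \<noteq> v"
    and two: "two_connected (V - {v}) (contract u v u E - {merge u v u ` e})"
  shows "two_connected V (E - {e})"
proof -
  let ?m = "merge u v u" and ?C = "contract u v u E - {merge u v u ` e}" and ?E = "E - {e}"
  have tV: "t1 \<in> V" "t1 \<noteq> v" "t2 \<in> V" "t2 \<noteq> u"
    using simple_graphD[OF G(1), of v t1] simple_graphD[OF G(1), of u t2] t by auto
  have uvE: "{u, v} \<in> ?E" "{v, u} \<in> ?E" using e uv(3) by (auto simp: insert_commute)
  \<comment> \<open>\<open>d'\<close> is the vertex of the contraction that stands for
    \<open>d\<close>; the merged vertex \<open>u\<close> stands for \<open>v\<close> as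
    well.\<close>
  have lift: "conn_in ?E (V - {d}) x y"
    if d: "d \<in> V" "d' = (if d = v then u else d)"
      and xy: "x \<in> V - {v} - {d'}" "y \<in> V - {v} - {d'}" for d d' x y
  proof -
    have "conn_in ?C (V - {v} - {d'}) x y"
      using xy d distinct by (intro two_connectedD[OF two]) (auto split: if_splits)
    then show ?thesis
    proof (rule conn_in_map[where f = "\<lambda>a. a"])
      fix a b assume ab: "{a, b} \<in> ?C" "a \<in> V - {v} - {d'}" "b \<in> V - {v} - {d'}"
      then obtain a0 b0 where 0: "{a0, b0} \<in> E" "?m a0 = a" "?m b0 = b"
        using contract_edgeE[OF G(1), of a b u v u] by blast
      have "{a0, b0} \<noteq> e" using ab(1) 0 by auto
      then have E0: "{a0, b0} \<in> ?E" using 0 by blast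
      have near: "z0 \<in> V - {d} \<and> conn_in ?E (V - {d}) z0 z"
        if "?m z0 = z" "z0 \<in> V" "z \<in> V - {v} - {d'}" for z z0
      proof (cases "z0 = z")
        case True
        then show ?thesis using that d(2) by (auto split: if_splits)
      next
        case False
        then have "z0 = v" "z = u" using that(1) by (auto simp: merge_def split: if_splits)
        then show ?thesis using that uvE d(2) distinct by (auto intro!: conn_in_edge split: if_splits)
      qed
      have "a0 \<in> V" "b0 \<in> V" using simple_graphD[OF G(1) 0(1)] by auto
      then have n: "a0 \<in> V - {d}" "conn_in ?E (V - {d}) a0 a" "b0 \<in> V - {d}" "conn_in ?E (V - {d}) b0 b"
        using near[OF 0(2) _ ab(2)] near[OF 0(3) _ ab(3)] by blast+
      have "conn_in ?E (V - {d}) a a0" using n(2) by (rule conn_in_sym)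
      also have "conn_in ?E (V - {d}) a0 b0" using E0 n by (intro conn_in_edge)
      also note n(4)
      finally show "conn_in ?E (V - {d}) a b" .
    qed
  qed
  have rep: "\<exists>x'\<in>V - {v} - {d'}. conn_in ?E (V - {d}) x x'"
    if d: "d \<in> V" "d' = (if d = v then u else d)" and x: "x \<in> V - {d}" for d d' x
  proof (cases "x \<in> V - {v} - {d'}")
    case True
    then show ?thesis by blast
  next
    case False
    then consider "x = v" "d = u" | "x = v" "d \<noteq> u" "d \<noteq> v" | "x = u" "d = v"
      using x d by (auto split: if_splits)
    then show ?thesis
    proof cases
      case 1
      then have "conn_in ?E (V - {d}) x t1" using t tV x by (intro conn_in_edge) auto
      then show ?thesis using 1 d tV t by (intro bexI[of _ t1]) auto
    next
      case 2
      then have "conn_in ?E (V - {d}) x u" using uvE x distinct by (intro conn_in_edge) auto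
      then show ?thesis using 2 d distinct by (intro bexI[of _ u]) auto
    next
      case 3
      then have "conn_in ?E (V - {d}) x t2" using t tV x by (intro conn_in_edge) auto
      then show ?thesis using 3 d tV t by (intro bexI[of _ t2]) auto
    qed
  qed
  show ?thesis
    unfolding two_connected_def
  proof (intro ballI)
    fix d x y assume d: "d \<in> V" and xy: "x \<in> V - {d}" "y \<in> V - {d}"
    obtain x' y' where x': "x' \<in> V - {v} - {if d = v then u else d}" "conn_in ?E (V - {d}) x x'"
      and y': "y' \<in> V - {v} - {if d = v then u else d}" "conn_in ?E (V - {d}) y y'"
      using rep[OF d refl xy(1)] rep[OF d refl xy(2)] by blast
    note x'(2)
    also have "conn_in ?E (V - {d}) x' y'" using lift[OF d refl x'(1) y'(1)] .
    also have "conn_in ?E (V - {d}) y' y" using y'(2) by (rule conn_in_sym)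
    finally show "conn_in ?E (V - {d}) x y" .
  qed
qed

definition incident :: "'a set set \<Rightarrow> 'a \<Rightarrow> 'a set set" where
  "incident E x = {e \<in> E. x \<in> e}"

lemma incident_other:
  assumes G: "simple_graph V E" and "card (incident E x) > card X" "finite X"
  obtains t where "{x, t} \<in> E" "{x, t} \<notin> X"
proof -
  have "\<not> incident E x \<subseteq> X" using card_mono[OF assms(3), of "incident E x"] assms(2) by auto
  then obtain e where e: "e \<in> E" "x \<in> e" "e \<notin> X" by (auto simp: incident_def)
  obtain a b where "e = {a, b}" using simple_graph_edge[OF G e(1)] by metis
  then show ?thesis using e that[of a] that[of b] by (auto simp: insert_commute)
qed

lemma incident_two:
  assumes G: "simple_graph V E" and "card (incident E x) = 2" "{x, y} \<in> E"
  obtains s where "{x, s} \<in> E" "s \<noteq> y" "s \<noteq> x" "\<And>t. {x, t} \<in> E \<Longrightarrow> t = y \<or> t = s"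
proof -
  obtain s where s: "{x, s} \<in> E" "{x, s} \<notin> {{x, y}}"
    using incident_other[OF G, of "{{x, y}}" x] assms(2) by auto
  have fin: "finite (incident E x)" using assms(2) card.infinite by fastforce
  have sub: "{{x, y}, {x, s}} \<subseteq> incident E x" using s assms(3) by (simp add: incident_def)
  have "card {{x, y}, {x, s}} = 2" using s by simp
  then have "incident E x = {{x, y}, {x, s}}" using card_subset_eq[OF fin sub] assms(2) by simp
  moreover have "{x, t} \<in> incident E x" if "{x, t} \<in> E" for t using that by (simp add: incident_def)
  ultimately have "t = y \<or> t = s" if "{x, t} \<in> E" for t
    using that by (auto simp: doubleton_eq_iff)
  moreover have "s \<noteq> y" "s \<noteq> x" using s simple_graphD(3)[OF G s(1)] by auto
  ultimately show ?thesis using that s(1) by blast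
qed

lemma (in edge_cut) min_two_connected_contract:
  assumes min: "\<And>e. e \<in> E \<Longrightarrow> \<not> two_connected V (E - {e})" and card: "card V \<ge> 4"
    and deg: "(card (incident E u) \<ge> 3 \<and> card (incident E v) \<ge> 3) \<or>
      (card (incident E u) = 2 \<and> card (incident E v) = 2)"
  shows "min_two_connected (V - {v}) (contract u v u E)"
  unfolding min_two_connected_def
proof (intro conjI ballI notI)
  let ?C = "contract u v u E"
  have fin: "finite V" using G by (simp add: simple_graph_def)
  have card': "card (V - {v}) \<ge> 3" using card distinct fin by simp
  show "simple_graph (V - {v}) ?C" using simple_graph_contract[OF G(1)] distinct by blast
  show "two_connected (V - {v}) ?C" by (rule two_connected_contract)
  fix e' assume e': "e' \<in> ?C" and two: "two_connected (V - {v}) (?C - {e'})"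
  obtain e where e: "e \<in> E" "e \<noteq> {u, v}" "e' = merge u v u ` e"
    using e' by (auto simp: contract_def)
  have "\<not> two_connected (V - {v}) (?C - {merge u v u ` e})"
    if t: "{v, t1} \<in> E" "{v, t1} \<notin> {e, {u, v}}" "{u, t2} \<in> E" "{u, t2} \<notin> {e, {u, v}}" for t1 t2
  proof -
    have "t1 \<noteq> u" "t2 \<noteq> v" using t(2,4) by (auto simp: insert_commute)
    then show ?thesis
      using two_connected_uncontract[OF e(2), of t1 t2] t min[OF e(1)] by auto
  qed
  then have no_t: False if "{v, t1} \<in> E" "{v, t1} \<notin> {e, {u, v}}" "{u, t2} \<in> E" "{u, t2} \<notin> {e, {u, v}}" for t1 t2
    using that two e(3) by blast
  from deg show False
  proof
    assume deg3: "card (incident E u) \<ge> 3 \<and> card (incident E v) \<ge> 3"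
    have le2: "card {e, {u, v}} \<le> 2" using card_insert_le_m1[of 2 "{{u, v}}" e] by simp
    obtain t1 where t1: "{v, t1} \<in> E" "{v, t1} \<notin> {e, {u, v}}"
      by (rule incident_other[OF G(1), of "{e, {u, v}}" v]) (use deg3 le2 in auto)
    obtain t2 where t2: "{u, t2} \<in> E" "{u, t2} \<notin> {e, {u, v}}"
      by (rule incident_other[OF G(1), of "{e, {u, v}}" u]) (use deg3 le2 in auto)
    show False using no_t[OF t1 t2] .
  next
    assume deg2: "card (incident E u) = 2 \<and> card (incident E v) = 2"
    have vuE: "{v, u} \<in> E" using uv(3) by (simp add: insert_commute)
    obtain s where s: "{u, s} \<in> E" "s \<noteq> v" "s \<noteq> u" "\<And>t. {u, t} \<in> E \<Longrightarrow> t = v \<or> t = s"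
      using incident_two[OF G(1) _ uv(3)] deg2 by metis
    obtain t where t: "{v, t} \<in> E" "t \<noteq> u" "t \<noteq> v" "\<And>x. {v, x} \<in> E \<Longrightarrow> x = u \<or> x = t"
      using incident_two[OF G(1) _ vuE] deg2 by metis
    have stV: "s \<in> V" "t \<in> V" using simple_graphD(2)[OF G(1)] s(1) t(1) by auto
    have nb: "b = s \<or> b = t" if ub: "{u, b} \<in> ?C" "b \<noteq> u" for b
    proof -
      obtain a0 b0 where 0: "{a0, b0} \<in> E" "{a0, b0} \<noteq> {u, v}" "merge u v u a0 = u" "merge u v u b0 = b"
        using contract_edgeE[OF G(1) ub(1)] .
      have "b0 = b" "b0 \<noteq> u" "b0 \<noteq> v" using 0(4) ub(2) by (auto simp: merge_def split: if_splits)
      moreover have "a0 = u \<or> a0 = v" using 0(3) by (auto simp: merge_def split: if_splits)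
      ultimately show ?thesis using s(4)[of b0] t(4)[of b0] 0(1) by auto
    qed
    have "{v, t} \<noteq> {u, v}" "{u, s} \<noteq> {u, v}" using s t by (auto simp: doubleton_eq_iff)
    then have "e = {v, t} \<or> e = {u, s}" using no_t[of t s] s(1) t(1) by auto
    then have e'_eq: "e' = {u, t} \<or> e' = {u, s}"
      using e(3) s t distinct by auto
    have "\<exists>d\<in>V - {v}. d \<noteq> u \<and> (\<forall>b. {u, b} \<in> ?C - {e'} \<longrightarrow> b \<noteq> u \<longrightarrow> b = d)"
      using e'_eq
    proof
      assume "e' = {u, t}"
      then show ?thesis using nb s stV by (intro bexI[of _ s]) auto
    next
      assume "e' = {u, s}"
      then show ?thesis using nb t stV by (intro bexI[of _ t]) auto
    qed
    then show False
      using pendant_not_two_connected[OF _ card', of u _ "?C - {e'}"] fin distinct two by blast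
  qed
qed

section \<open>Joining a new vertex to a pair of vertices\<close>

definition ear :: "'a \<Rightarrow> 'a \<Rightarrow> 'a \<Rightarrow> 'a set set \<Rightarrow> 'a set set" where
  "ear p q z E = insert {p, z} (insert {q, z} E)"

text \<open>Of three disjoint connections, deleting a vertex and an edge destroys at most
  two.\<close>

lemma linked_conn_avoiding:
  assumes G: "simple_graph V E" and pq: "p \<in> V" "q \<in> V" "p \<noteq> q" "linked E p q 3"
    and e: "e \<in> E" and d: "d \<noteq> p" "d \<noteq> q"
  shows "conn_in (E - {e}) (V - {d}) p q"
proof (cases "{p, q} \<in> E - {e}")
  case True
  then show ?thesis using pq d by (intro conn_in_edge) auto
next
  case False
  obtain F where F: "link_family E p q F" "3 \<le> card F + of_bool ({p, q} \<in> E)" "\<And>I. I \<in> F \<Longrightarrow> I \<subseteq> V"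
    using linked_in_verts[OF G pq(4,1,2,3)] by metis
  \<comment> \<open>A link can use an edge other than \<open>pq\<close> only if it contains
    \<open>s\<close>. If \<open>e\<close> is \<open>pq\<close>, no link uses it, and
    \<open>s\<close> is arbitrary.\<close>
  obtain s where s: "e = {p, q} \<or> (s \<in> e \<and> s \<noteq> p \<and> s \<noteq> q)"
  proof -
    obtain a b where ab: "e = {a, b}" "a \<noteq> b" using simple_graph_edge[OF G e] .
    consider "e = {p, q}" | "a \<noteq> p \<and> a \<noteq> q" | "b \<noteq> p \<and> b \<noteq> q" using ab by auto
    then show ?thesis
    proof cases
      case 1
      then show ?thesis by (intro that[of a] disjI1)
    next
      case 2
      then show ?thesis using ab(1) by (intro that[of a] disjI2) simp
    next
      case 3
      then show ?thesis using ab(1) by (intro that[of b] disjI2) simp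
    qed
  qed
  have "\<exists>I\<in>F. d \<notin> I \<and> (e = {p, q} \<or> s \<notin> I)"
  proof (rule ccontr)
    assume none: "\<not> ?thesis"
    have bound: "card F \<le> card X" if "finite X" "\<And>I. I \<in> F \<Longrightarrow> I \<inter> X \<noteq> {}" for X
      using disjoint_family_transversal[OF _ that] F(1) by (simp add: link_family_def)
    show False
    proof (cases "e = {p, q}")
      case True
      then have "card F \<le> card {d}" using none by (intro bound) auto
      moreover have "of_bool ({p, q} \<in> E) \<le> (1 :: nat)" by simp
      ultimately show False using F(2) by simp
    next
      case ne: False
      have "card F \<le> card {d, s}" using none ne by (intro bound) auto
      moreover have "card {d, s} \<le> 2" using card_insert_le_m1[of 2 "{s}" d] by simp
      moreover have "{p, q} \<notin> E" using False ne by auto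
      ultimately show False using F(2) by simp
    qed
  qed
  then obtain I where I: "I \<in> F" "d \<notin> I" "e = {p, q} \<or> s \<notin> I" by blast
  have "conn_in (E - {{p, q}}) (insert p (insert q I)) p q"
    using F(1) I(1) by (auto simp: link_family_def link_def)
  then have "conn_in (E - {e}) (insert p (insert q I)) p q"
  proof (rule conn_in_edges)
    fix a b assume ab: "{a, b} \<in> E - {{p, q}}" "a \<in> insert p (insert q I)" "b \<in> insert p (insert q I)"
    have "{a, b} \<noteq> e" using ab s I(3) by blast
    then show "{a, b} \<in> E - {e}" using ab by blast
  qed
  then show ?thesis by (rule conn_in_mono) (use I(2) F(3)[OF I(1)] pq d in auto)
qed

locale ear_extension =
  fixes V :: "'a set" and E p q z
  assumes min: "min_two_connected V E" and card_V: "card V \<ge> 3"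
    and pq: "p \<in> V" "q \<in> V" "p \<noteq> q" "linked E p q 3" and z: "z \<notin> V"
begin

lemma G: "simple_graph V E" "two_connected V E" "\<And>e. e \<in> E \<Longrightarrow> \<not> two_connected V (E - {e})"
  using min by (auto simp: min_two_connected_def)

lemma z_edges: "{z, b} \<in> ear p q z E \<Longrightarrow> b = p \<or> b = q" "{z, b} \<notin> E" "{b, z} \<notin> E" "p \<noteq> z" "q \<noteq> z"
proof -
  show ne: "{z, b} \<notin> E" "{b, z} \<notin> E" "p \<noteq> z" "q \<noteq> z" for b
    using simple_graphD(1,2)[OF G(1)] z pq by blast+
  then show "{z, b} \<in> ear p q z E \<Longrightarrow> b = p \<or> b = q" for b
    by (auto simp: ear_def doubleton_eq_iff)
qed

lemma old_edges: "{a, b} \<in> ear p q z E \<Longrightarrow> a \<noteq> z \<Longrightarrow> b \<noteq> z \<Longrightarrow> {a, b} \<in> E"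
  by (auto simp: ear_def doubleton_eq_iff)

lemma simple_graph_ear: "simple_graph (insert z V) (ear p q z E)"
proof -
  have "card {p, z} = 2" "card {q, z} = 2" using z_edges(4,5) by simp_all
  then show ?thesis using G(1) pq z by (auto simp: simple_graph_def ear_def)
qed

lemma two_connected_ear: "two_connected (insert z V) (ear p q z E)"
  unfolding two_connected_def
proof (intro ballI)
  have fin: "finite V" using G(1) by (simp add: simple_graph_def)
  fix d x y
  assume d: "d \<in> insert z V" and x: "x \<in> insert z V - {d}" and y: "y \<in> insert z V - {d}"
  let ?S = "insert z V - {d}" and ?E = "ear p q z E"
  have old: "conn_in ?E ?S a b" if "a \<in> V - {d}" "b \<in> V - {d}" for a b
  proof (cases "d = z")
    case True
    have "conn_in E V a b" using that two_connected_conn[OF G(2) fin card_V] by blast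
    then show ?thesis by (rule conn_in_mono) (use True z in \<open>auto simp: ear_def\<close>)
  next
    case False
    then have "conn_in E (V - {d}) a b" using that d by (intro two_connectedD[OF G(2)]) auto
    then show ?thesis by (rule conn_in_mono) (auto simp: ear_def)
  qed
  have rep: "\<exists>a'\<in>V - {d}. conn_in ?E ?S a a'" if "a \<in> ?S" for a
  proof (cases "a = z")
    case True
    obtain r where r: "r \<in> {p, q}" "r \<noteq> d" using pq(3) by auto
    have "{z, r} \<in> ?E" using r(1) by (auto simp: ear_def insert_commute)
    then have "conn_in ?E ?S z r" using r True that pq by (intro conn_in_edge) auto
    then show ?thesis using r pq True by (intro bexI[of _ r]) auto
  qed (use that in auto)
  obtain x' y' where xy: "x' \<in> V - {d}" "conn_in ?E ?S x x'" "y' \<in> V - {d}" "conn_in ?E ?S y y'"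
    using rep[OF x] rep[OF y] by blast
  note xy(2)
  also have "conn_in ?E ?S x' y'" using old xy by blast
  also have "conn_in ?E ?S y' y" using xy(4) by (rule conn_in_sym)
  finally show "conn_in ?E ?S x y" .
qed

lemma ear_old_edge_essential:
  assumes e: "e \<in> E"
  shows "\<not> two_connected (insert z V) (ear p q z E - {e})"
proof
  assume two: "two_connected (insert z V) (ear p q z E - {e})"
  have "two_connected V (E - {e})"
    unfolding two_connected_def
  proof (intro ballI)
    fix d x y assume d: "d \<in> V" and xy: "x \<in> V - {d}" "y \<in> V - {d}"
    let ?R = "conn_in (E - {e}) (V - {d}) x"
    have "conn_in (ear p q z E - {e}) (insert z V - {d}) x y"
      using d xy by (intro two_connectedD[OF two]) auto
    \<comment> \<open>A walk standing at \<open>z\<close> may continue to either neighbour, so the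
      invariant there says that both, unless deleted, are reachable without
      \<open>z\<close>.\<close>
    then have "(y \<noteq> z \<longrightarrow> ?R y) \<and> (y = z \<longrightarrow> (\<forall>r\<in>{p, q} - {d}. ?R r))"
    proof (induction rule: rtranclp_induct)
      case base
      then show ?case using xy z by auto
    next
      case (step a b)
      have ab: "{a, b} \<in> ear p q z E - {e}" "a \<in> insert z V - {d}" "b \<in> insert z V - {d}"
        using step.hyps(2) by (simp_all add: adj_in_def)
      have "?R b" if "b \<noteq> z"
      proof (cases "a = z")
        case True
        then have "b \<in> {p, q} - {d}" using z_edges(1)[of b] ab by auto
        then show ?thesis using step.IH True by blast
      next
        case False
        then have "{a, b} \<in> E - {e}" using old_edges[of a b] ab(1) that by blast
        then have "conn_in (E - {e}) (V - {d}) a b" using ab that False by (intro conn_in_edge) auto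
        then show ?thesis using step.IH False by (auto intro: rtranclp_trans)
      qed
      moreover have "?R r" if "b = z" "r \<in> {p, q} - {d}" for r
      proof -
        have "{a, z} \<in> ear p q z E" using that(1) ab(1) by simp
        then have "{z, a} \<in> ear p q z E" by (simp only: insert_commute)
        then have a: "a \<in> {p, q} - {d}" "a \<noteq> z" using z_edges ab by auto
        have "conn_in (E - {e}) (V - {d}) a r"
        proof (cases "a = r")
          case False
          have "d \<noteq> p" "d \<noteq> q" using False a that by auto
          then have "conn_in (E - {e}) (V - {d}) p q"
            using linked_conn_avoiding[OF G(1) pq e] by blast
          then show ?thesis using False a that conn_in_sym[of "E - {e}" "V - {d}" p q] by auto
        qed simp
        then show ?thesis using step.IH a by (auto intro: rtranclp_trans)
      qed
      ultimately show ?case by blast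
    qed
    then show "?R y" using xy z by auto
  qed
  then show False using G(3)[OF e] by blast
qed

lemma min_two_connected_ear: "min_two_connected (insert z V) (ear p q z E)"
proof -
  have fin: "finite (insert z V)" using G(1) by (simp add: simple_graph_def)
  have card': "card (insert z V) \<ge> 3" using card_V fin z by simp
  have "\<not> two_connected (insert z V) (ear p q z E - {{p, z}})"
  proof (rule pendant_not_two_connected[OF fin card', of z q])
    show "b = q" if "{z, b} \<in> ear p q z E - {{p, z}}" for b
      using z_edges(1)[of b] that by (auto simp: insert_commute)
  qed (use pq z_edges in auto)
  moreover have "\<not> two_connected (insert z V) (ear p q z E - {{q, z}})"
  proof (rule pendant_not_two_connected[OF fin card', of z p])
    show "b = p" if "{z, b} \<in> ear p q z E - {{q, z}}" for b
      using z_edges(1)[of b] that by (auto simp: insert_commute)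
  qed (use pq z_edges in auto)
  ultimately have "\<not> two_connected (insert z V) (ear p q z E - {e})" if "e \<in> ear p q z E" for e
    using that ear_old_edge_essential[of e] by (auto simp: ear_def)
  then show ?thesis using simple_graph_ear two_connected_ear by (simp add: min_two_connected_def)
qed

lemma linked_ear: "linked E x y k \<Longrightarrow> linked (ear p q z E) x y k"
  by (erule linked_edge_mono) (auto simp: ear_def)

lemma linked_ear_ends:
  assumes "linked E p q k"
  shows "linked (ear p q z E) p q (Suc k)"
proof -
  obtain F where F: "link_family E p q F" "k \<le> card F + of_bool ({p, q} \<in> E)" "\<And>I. I \<in> F \<Longrightarrow> I \<subseteq> V"
    using linked_in_verts[OF G(1) assms pq(1,2,3)] by metis
  let ?E = "ear p q z E - {{p, q}}"
  have ne: "{p, z} \<noteq> {p, q}" "{q, z} \<noteq> {p, q}" using z_edges(4,5) by (auto simp: doubleton_eq_iff)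
  have "{p, z} \<in> ?E" "{z, q} \<in> ?E" using ne by (auto simp: ear_def insert_commute)
  then have "conn_in ?E {p, q, z} p z" "conn_in ?E {p, q, z} z q" by (auto intro!: conn_in_edge)
  then have "conn_in ?E {p, q, z} p q" by (rule rtranclp_trans)
  then have zl: "link (ear p q z E) p q {z}" using z_edges by (simp add: link_def)
  have zF: "z \<notin> I" if "I \<in> F" for I using F(3)[OF that] z by blast
  have "link_family (ear p q z E) p q (insert {z} F)"
    unfolding link_family_def
  proof (intro conjI ballI)
    show "finite (insert {z} F)" using F(1) by (simp add: link_family_def)
    show "link (ear p q z E) p q I" if "I \<in> insert {z} F" for I
      using that zl F(1) link_mono[of E p q I "ear p q z E"] by (auto simp: link_family_def ear_def)
    show "pairwise disjnt (insert {z} F)"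
      using F(1) zF by (auto simp: link_family_def pairwise_insert disjnt_def)
  qed
  moreover have "card (insert {z} F) = Suc (card F)"
    using zF F(1) by (subst card_insert_disjoint) (auto simp: link_family_def)
  moreover have "{p, q} \<in> ear p q z E" if "{p, q} \<in> E" using that by (simp add: ear_def)
  then have "of_bool ({p, q} \<in> E) \<le> (of_bool ({p, q} \<in> ear p q z E) :: nat)" by auto
  ultimately show ?thesis using F(2) linkedI[of "ear p q z E" p q "insert {z} F" "Suc k"] by linarith
qed

end

section \<open>The complete bipartite graph K(2, m) with hubs a and b\<close>

definition two_hub :: "'a set \<Rightarrow> 'a \<Rightarrow> 'a \<Rightarrow> 'a set set" where
  "two_hub W a b = (\<lambda>x. {a, x}) ` W \<union> (\<lambda>x. {b, x}) ` W"

lemma two_hub: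
  assumes W: "finite W" "card W \<ge> 2" and ab: "a \<notin> W" "b \<notin> W" "a \<noteq> b"
  shows "min_two_connected (insert a (insert b W)) (two_hub W a b)"
    and "linked (two_hub W a b) a b (card W)"
    and "x \<in> W \<Longrightarrow> {x, y} \<in> two_hub W a b \<Longrightarrow> y = a \<or> y = b"
proof -
  let ?V = "insert a (insert b W)" and ?E = "two_hub W a b"
  show nb: "y = a \<or> y = b" if xy: "x \<in> W" "{x, y} \<in> two_hub W a b" for x y
  proof -
    obtain w h where "w \<in> W" "h = a \<or> h = b" "{x, y} = {h, w}"
      using xy(2) unfolding two_hub_def by blast
    moreover have "x \<noteq> a" "x \<noteq> b" using xy(1) ab by blast+
    ultimately show ?thesis unfolding doubleton_eq_iff by blast
  qed
  have edges: "{a, x} \<in> ?E" "{x, a} \<in> ?E" "{b, x} \<in> ?E" "{x, b} \<in> ?E" if "x \<in> W" for x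
    using that by (auto simp: two_hub_def insert_commute)
  have "card {h, x} = 2" if "x \<in> W" "h = a \<or> h = b" for h x
  proof -
    have "h \<noteq> x" using that ab by blast
    then show ?thesis by simp
  qed
  then have simple: "simple_graph ?V ?E" using W by (auto simp: simple_graph_def two_hub_def)
  have hub: "conn_in ?E (?V - {d}) x h"
    if x: "x \<in> ?V - {d}" and h: "h = a \<and> h' = b \<or> h = b \<and> h' = a" "h \<noteq> d" for x d h h'
  proof -
    have hE: "{y, h} \<in> ?E" "{h', y} \<in> ?E" if "y \<in> W" for y
      using edges[OF that] h(1) by auto
    have hV: "h \<in> ?V" "h' \<in> ?V" using h by auto
    consider "x \<in> W" | "x = h" | "x = h'" using x h(1) by auto
    then show ?thesis
    proof cases
      case 1
      then show ?thesis using hE(1) hV x h(2) by (intro conn_in_edge) auto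
    next
      case 3
      \<comment> \<open>The hubs are joined through a common neighbour that survives the deletion of
        \<open>d\<close>; this uses \<open>card W \<ge> 2\<close>.\<close>
      have "\<not> W \<subseteq> {d}" using card_mono[of "{d}" W] W by auto
      then obtain w where w: "w \<in> W" "w \<noteq> d" by blast
      have "conn_in ?E (?V - {d}) h' w" using 3 w(2) hE(2)[OF w(1)] w(1) hV x by (intro conn_in_edge) auto
      also have "conn_in ?E (?V - {d}) w h" using w(2) hE(1)[OF w(1)] w(1) hV h(2) by (intro conn_in_edge) auto
      finally show ?thesis using 3 by simp
    qed simp
  qed
  have two: "two_connected ?V ?E"
    unfolding two_connected_def
  proof (intro ballI)
    fix d x y assume xy: "x \<in> ?V - {d}" "y \<in> ?V - {d}"
    obtain h h' where h: "h = a \<and> h' = b \<or> h = b \<and> h' = a" "h \<noteq> d" using ab(3) by (cases "a = d") auto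
    show "conn_in ?E (?V - {d}) x y"
      using hub[OF xy(1) h] conn_in_sym[OF hub[OF xy(2) h]] by (rule rtranclp_trans)
  qed
  have card: "card ?V \<ge> 3" "finite ?V" using W ab by simp_all
  have "\<not> two_connected ?V (?E - {{h, x}})"
    if x: "x \<in> W" and h: "h = a \<and> h' = b \<or> h = b \<and> h' = a" for x h h'
  proof (rule pendant_not_two_connected[OF card(2,1), of x h'])
    show "y = h'" if y: "{x, y} \<in> ?E - {{h, x}}" for y
    proof -
      have "y \<noteq> h" using y by (auto simp: insert_commute)
      then show ?thesis using nb[OF x, of y] y h by auto
    qed
    show "x \<in> ?V" "h' \<in> ?V" "h' \<noteq> x" using x h ab by auto
  qed
  then have "\<not> two_connected ?V (?E - {e})" if "e \<in> ?E" for e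
    using that unfolding two_hub_def by (auto simp: insert_commute)
  then show "min_two_connected ?V ?E" using simple two by (simp add: min_two_connected_def)
  have "link ?E a b {x}" if "x \<in> W" for x
  proof -
    have "{a, x} \<in> ?E - {{a, b}}" "{x, b} \<in> ?E - {{a, b}}"
      using edges[OF that] that ab by (auto simp: doubleton_eq_iff)
    then have "conn_in (?E - {{a, b}}) {a, b, x} a x" "conn_in (?E - {{a, b}}) {a, b, x} x b"
      by (auto intro!: conn_in_edge)
    then have "conn_in (?E - {{a, b}}) {a, b, x} a b" by (rule rtranclp_trans)
    then show ?thesis using that ab by (auto simp: link_def)
  qed
  then have "link_family ?E a b ((\<lambda>x. {x}) ` W)"
    using W(1) by (auto simp: link_family_def pairwise_def disjnt_def)
  then show "linked ?E a b (card W)" by (rule linkedI) (simp add: card_image)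
qed

section \<open>Transfer to multigraphs\<close>

lemma graph_connected_delete_verts_iff:
  assumes "finite_loopless G"
  shows "graph_connected (delete_verts G S) \<longleftrightarrow>
    (\<forall>x\<in>verts G - S. \<forall>y\<in>verts G - S. conn_in (edge_sets G) (verts G - S) x y)"
proof -
  let ?H = "delete_verts G S" and ?V = "verts G - S"
  have H: "verts ?H = ?V" "edge_sets ?H \<subseteq> edge_sets G"
    "\<And>e. e \<in> edge_sets G \<Longrightarrow> e \<inter> S = {} \<Longrightarrow> e \<in> edge_sets ?H"
    by (auto simp: delete_verts_def)
  have "(\<exists>p. path_between ?H x y p) \<longleftrightarrow> conn_in (edge_sets G) ?V x y"
    if xy: "x \<in> ?V" "y \<in> ?V" for x y
  proof
    assume "\<exists>p. path_between ?H x y p"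
    then obtain vs es where p: "path_between ?H x y (vs, es)" by auto
    have "ends ?H ` set es \<subseteq> edge_sets G" "set vs \<subseteq> ?V"
      using path_between_nth(5,6)[OF p] H(1,2) by blast+
    then show "conn_in (edge_sets G) ?V x y" by (rule conn_in_mono[OF path_between_conn_in[OF p]])
  next
    assume "conn_in (edge_sets G) ?V x y"
    then have "conn_in (edge_sets ?H) ?V x y" by (rule conn_in_edges) (intro H(3), auto)
    then obtain vs where vs: "vpath (edge_sets ?H) x y vs" "set vs \<subseteq> verts ?H"
      unfolding H(1) using vpath_exists xy(1) by metis
    obtain es where "path_between ?H x y (vs, es)"
      using vpath_path_between[OF vs order_refl] by blast
    then show "\<exists>p. path_between ?H x y p" ..
  qed
  then show ?thesis by (simp add: graph_connected_def H(1))
qed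

text \<open>With at least three vertices, deleting at most one never leaves the trivial graph, so
  only disconnection counts. Deleting all vertices but one shows that the minimum in
  \<open>connectivity\<close> exists.\<close>

lemma connectivity_two_iff:
  assumes G: "finite_loopless G" and card: "order G \<ge> 3"
  shows "2 \<le> connectivity G \<longleftrightarrow> two_connected (verts G) (edge_sets G)"
proof -
  let ?V = "verts G" and ?E = "edge_sets G"
  define P where "P k \<longleftrightarrow> (\<exists>S\<subseteq>?V. card S = k \<and>
     (\<not> graph_connected (delete_verts G S) \<or> order (delete_verts G S) = 1))" for k
  have conn: "connectivity G = (LEAST k. P k)" by (simp add: connectivity_def P_def)
  have fin: "finite ?V" using G by (simp add: finite_loopless_def)
  have n: "card ?V \<ge> 3" using card by (simp add: order_def)
  have "?V \<noteq> {}" using n by auto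
  then obtain v where v: "v \<in> ?V" by blast
  have order: "order (delete_verts G S) = card ?V - card S" if "S \<subseteq> ?V" for S
    using that fin by (simp add: order_def delete_verts_def card_Diff_subset finite_subset)
  have "P (card ?V - 1)"
    unfolding P_def using v fin n order[of "?V - {v}"] by (intro exI[of _ "?V - {v}"]) auto
  then have least: "P (connectivity G)" unfolding conn by (rule LeastI)
  have "connectivity G \<le> k" if "P k" for k unfolding conn using that by (rule Least_le)
  from this[of 0] this[of 1] least have "2 \<le> connectivity G \<longleftrightarrow> \<not> P 0 \<and> \<not> P 1"
    by (cases "connectivity G = 0 \<or> connectivity G = 1") auto
  moreover have "P 0 \<longleftrightarrow> \<not> graph_connected (delete_verts G {})"
  proof -
    have "order (delete_verts G {}) \<noteq> 1" using n order[of "{}"] by simp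
    moreover have "card S = 0 \<longleftrightarrow> S = {}" if "S \<subseteq> ?V" for S
      using card_0_eq[OF finite_subset[OF that fin]] .
    ultimately show ?thesis unfolding P_def by (metis empty_subsetI)
  qed
  moreover have "P 1 \<longleftrightarrow> (\<exists>d\<in>?V. \<not> graph_connected (delete_verts G {d}))"
  proof -
    have "order (delete_verts G {d}) \<noteq> 1" if "d \<in> ?V" for d using that n order[of "{d}"] by simp
    then have "\<exists>d\<in>?V. \<not> graph_connected (delete_verts G {d})" if "P 1"
      using that unfolding P_def by (metis card_1_singletonE insert_subset)
    moreover have "P 1" if "d \<in> ?V" "\<not> graph_connected (delete_verts G {d})" for d
      unfolding P_def using that by (intro exI[of _ "{d}"]) simp
    ultimately show ?thesis by blast
  qed
  moreover have "graph_connected (delete_verts G {})" if "two_connected ?V ?E"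
    unfolding graph_connected_delete_verts_iff[OF G] using two_connected_conn[OF that fin n] by simp
  moreover have "two_connected ?V ?E \<longleftrightarrow> (\<forall>d\<in>?V. graph_connected (delete_verts G {d}))"
    unfolding graph_connected_delete_verts_iff[OF G] two_connected_def ..
  ultimately show ?thesis by blast
qed

text \<open>The set \<open>{p, q}\<close> separates \<open>z\<close> from a fourth vertex. The
  competitors constructed below contain such a \<open>z\<close>, and thus their connectivity is
  exactly 2.\<close>

lemma connectivity_le_two:
  assumes G: "finite_loopless G" and card: "order G \<ge> 4"
    and z: "z \<in> verts G" "p \<in> verts G" "q \<in> verts G" "p \<noteq> q" "z \<noteq> p" "z \<noteq> q"
    and nb: "\<And>b. {z, b} \<in> edge_sets G \<Longrightarrow> b = p \<or> b = q"
  shows "connectivity G \<le> 2"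
proof -
  have fin: "finite (verts G)" using G by (simp add: finite_loopless_def)
  obtain y where y: "y \<in> verts G" "y \<noteq> z" "y \<noteq> p" "y \<noteq> q"
    using fourth_vertex[OF fin, of z p q] card by (auto simp: order_def)
  have "\<not> conn_in (edge_sets G) (verts G - {p, q}) z y"
  proof
    assume "conn_in (edge_sets G) (verts G - {p, q}) z y"
    then have "y \<in> {z}" by (rule conn_in_closed) (use nb in auto)
    then show False using y by simp
  qed
  then have "\<not> graph_connected (delete_verts G {p, q})"
    unfolding graph_connected_delete_verts_iff[OF G] using y z by blast
  then show ?thesis
    unfolding connectivity_def using z by (intro Least_le exI[of _ "{p, q}"]) auto
qed

lemma edge_sets_delete_edge:
  assumes "inj_on (ends G) (edges G)" "e \<in> edges G"
  shows "edge_sets (delete_edge G e) = edge_sets G - {ends G e}"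
  using assms by (auto simp: delete_edge_def inj_on_def)

lemma finite_loopless_delete_edge: "finite_loopless G \<Longrightarrow> finite_loopless (delete_edge G e)"
  by (auto simp: finite_loopless_def delete_edge_def)

text \<open>Parallel edges contradict minimality: deleting one of them does not change
  \<open>edge_sets G\<close>, on which 2-connectedness depends.\<close>

lemma minimally_2_connectedD:
  assumes "minimally_2_connected G" "order G \<ge> 3"
  shows "finite_loopless G" "inj_on (ends G) (edges G)" "min_two_connected (verts G) (edge_sets G)"
proof -
  show G: "finite_loopless G" using assms(1) by (simp add: minimally_2_connected_def)
  have two: "two_connected (verts G) (edge_sets G)"
    using assms connectivity_two_iff[OF G] by (simp add: minimally_2_connected_def)
  have del: "\<not> two_connected (verts G) (edge_sets (delete_edge G e))" if "e \<in> edges G" for e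
  proof -
    have "verts (delete_edge G e) = verts G" by (simp add: delete_edge_def)
    moreover have "\<not> 2 \<le> connectivity (delete_edge G e)"
      using assms(1) that by (auto simp: minimally_2_connected_def)
    ultimately show ?thesis
      using connectivity_two_iff[OF finite_loopless_delete_edge[OF G], of e] assms(2)
      by (simp add: order_def)
  qed
  show inj: "inj_on (ends G) (edges G)"
  proof (rule inj_onI, rule ccontr)
    fix e f assume "e \<in> edges G" "f \<in> edges G" "ends G e = ends G f" "e \<noteq> f"
    then have "edge_sets (delete_edge G e) = edge_sets G" by (auto simp: delete_edge_def image_iff)
    then show False using del[OF \<open>e \<in> edges G\<close>] two by simp
  qed
  have "\<not> two_connected (verts G) (edge_sets G - {e})" if "e \<in> edge_sets G" for e
    using that del edge_sets_delete_edge[OF inj] by auto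
  then show "min_two_connected (verts G) (edge_sets G)"
    using two finite_loopless_simple_graph[OF G] by (simp add: min_two_connected_def)
qed

lemma minimally_2_connectedI:
  assumes G: "finite_loopless G" "inj_on (ends G) (edges G)" and card: "order G \<ge> 4"
    and min: "min_two_connected (verts G) (edge_sets G)"
    and z: "z \<in> verts G" "p \<in> verts G" "q \<in> verts G" "p \<noteq> q" "z \<noteq> p" "z \<noteq> q"
    and nb: "\<And>b. {z, b} \<in> edge_sets G \<Longrightarrow> b = p \<or> b = q"
  shows "minimally_2_connected G"
proof -
  have "2 \<le> connectivity G" using connectivity_two_iff[OF G(1)] min card by (simp add: min_two_connected_def)
  moreover have "connectivity G \<le> 2" using connectivity_le_two[OF G(1) card z nb] .
  moreover have "connectivity (delete_edge G e) < 2" if "e \<in> edges G" for e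
  proof -
    have "verts (delete_edge G e) = verts G" by (simp add: delete_edge_def)
    moreover have "\<not> two_connected (verts G) (edge_sets (delete_edge G e))"
      using min that edge_sets_delete_edge[OF G(2) that] by (auto simp: min_two_connected_def)
    ultimately show ?thesis
      using connectivity_two_iff[OF finite_loopless_delete_edge[OF G(1)], of e] card
      by (simp add: order_def)
  qed
  ultimately show ?thesis using G(1) card by (simp add: minimally_2_connected_def)
qed

lemma le_pair_connectivity_iff:
  assumes "finite_loopless G" "inj_on (ends G) (edges G)" "u \<in> verts G" "v \<in> verts G" "u \<noteq> v"
  shows "k \<le> pair_connectivity G {u, v} \<longleftrightarrow> linked (edge_sets G) u v k"
  unfolding pair_connectivity_doubleton[OF assms(5)] by (rule le_local_connectivity_iff[OF assms])

section \<open>Connectivity summed over pairs\<close>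

definition pairs :: "'a set \<Rightarrow> 'a set set" where
  "pairs V = {S. S \<subseteq> V \<and> card S = 2}"

lemma finite_pairs: "finite V \<Longrightarrow> finite (pairs V)"
  unfolding pairs_def by (rule finite_subset[of _ "Pow V"]) auto

lemma pairs_E:
  assumes "S \<in> pairs V"
  obtains x y where "S = {x, y}" "x \<noteq> y" "x \<in> V" "y \<in> V"
  using assms by (auto simp: pairs_def card_2_iff)

text \<open>Graphs of equal order share the denominator of the average, so it suffices to compare
  these natural numbers.\<close>

definition total_connectivity :: "('v, 'e) multigraph \<Rightarrow> nat" where
  "total_connectivity G = (\<Sum>S\<in>pairs (verts G). pair_connectivity G S)"

lemma average_connectivity_total:
  "average_connectivity G = real (total_connectivity G) / real (order G choose 2)"
  by (simp add: average_connectivity_def total_connectivity_def pairs_def)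

lemma total_connectivity_le:
  assumes G: "finite_loopless G" "inj_on (ends G) (edges G)"
    and H: "finite_loopless H" "inj_on (ends H) (edges H)"
    and h: "bij_betw h (verts G) (verts H)"
    and l: "\<And>u v k. u \<in> verts G \<Longrightarrow> v \<in> verts G \<Longrightarrow> u \<noteq> v \<Longrightarrow>
      linked (edge_sets G) u v k \<Longrightarrow> linked (edge_sets H) (h u) (h v) k"
  shows "total_connectivity G \<le> total_connectivity H"
proof -
  have inj: "inj_on h (verts G)" and surj: "h ` verts G = verts H" using h by (auto simp: bij_betw_def)
  have "inj_on ((`) h) (pairs (verts G))"
    by (rule inj_on_subset[OF inj_on_image_Pow[OF inj]]) (auto simp: pairs_def)
  moreover have "(`) h ` pairs (verts G) \<subseteq> pairs (verts H)"
    using inj surj by (auto simp: pairs_def card_image inj_on_subset)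
  moreover have "pair_connectivity G S \<le> pair_connectivity H (h ` S)" if S: "S \<in> pairs (verts G)" for S
  proof -
    obtain x y where xy: "S = {x, y}" "x \<noteq> y" "x \<in> verts G" "y \<in> verts G" using pairs_E[OF S] .
    have hxy: "h x \<noteq> h y" "h x \<in> verts H" "h y \<in> verts H" using inj surj xy by (auto simp: inj_on_def)
    have "linked (edge_sets G) x y (pair_connectivity G S)"
      using le_pair_connectivity_iff[OF G xy(3,4,2), of "pair_connectivity G S"] xy(1) by simp
    then show ?thesis
      using le_pair_connectivity_iff[OF H hxy(2,3,1)] l[OF xy(3,4,2)] xy(1) by simp
  qed
  moreover have "finite (pairs (verts H))" using H(1) by (intro finite_pairs) (simp add: finite_loopless_def)
  ultimately have *: "inj_on ((`) h) (pairs (verts G))" "(`) h ` pairs (verts G) \<subseteq> pairs (verts H)"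
    "\<And>S. S \<in> pairs (verts G) \<Longrightarrow> pair_connectivity G S \<le> pair_connectivity H (h ` S)"
    "finite (pairs (verts H))"
    by blast+
  have "total_connectivity G \<le> (\<Sum>S\<in>pairs (verts G). pair_connectivity H (h ` S))"
    unfolding total_connectivity_def using *(3) by (rule sum_mono)
  also have "\<dots> = sum (pair_connectivity H) ((`) h ` pairs (verts G))"
    using *(1) by (simp add: sum.reindex)
  also have "\<dots> \<le> total_connectivity H"
    unfolding total_connectivity_def using *(2,4) by (intro sum_mono2) auto
  finally show ?thesis .
qed

section \<open>Graphs with edges as their own labels, and renaming of vertices\<close>

definition graph_of :: "'a set \<Rightarrow> 'a set set \<Rightarrow> ('a, 'a set) multigraph" where
  "graph_of V E = \<lparr>verts = V, edges = E, ends = (\<lambda>e. e)\<rparr>"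

lemma graph_of_simps [simp]:
  "verts (graph_of V E) = V" "edges (graph_of V E) = E" "ends (graph_of V E) e = e"
  by (simp_all add: graph_of_def)

lemma graph_of_simple:
  assumes "simple_graph V E"
  shows "finite_loopless (graph_of V E)" "inj_on (ends (graph_of V E)) (edges (graph_of V E))"
    "edge_sets (graph_of V E) = E"
  using assms simple_graph_finite[OF assms]
  by (auto simp: simple_graph_def finite_loopless_def inj_on_def)

lemma inj_doubleton:
  assumes "inj_on h V" "a \<in> V" "b \<in> V" "x \<in> V" "y \<in> V" "{h a, h b} = {h x, h y}"
  shows "{a, b} = {x, y}"
  using assms by (auto simp: doubleton_eq_iff inj_on_def)

lemma two_connected_image:
  assumes "inj_on h V" "two_connected V E"
  shows "two_connected (h ` V) ((`) h ` E)"
  unfolding two_connected_def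
proof (intro ballI)
  fix d x y assume d: "d \<in> h ` V" and xy: "x \<in> h ` V - {d}" "y \<in> h ` V - {d}"
  then obtain d' x' y' where eq: "d = h d'" "x = h x'" "y = h y'" and V: "d' \<in> V" "x' \<in> V" "y' \<in> V"
    by blast
  have "conn_in E (V - {d'}) x' y'" using eq V xy by (intro two_connectedD[OF assms(2)]) auto
  then show "conn_in ((`) h ` E) (h ` V - {d}) x y"
    unfolding eq
  proof (rule conn_in_map)
    fix a b assume ab: "{a, b} \<in> E" "a \<in> V - {d'}" "b \<in> V - {d'}"
    have "h ` {a, b} \<in> (`) h ` E" using ab(1) by (rule imageI)
    then show "conn_in ((`) h ` E) (h ` V - {h d'}) (h a) (h b)"
      using ab(2,3) V(1) assms(1) by (intro conn_in_edge) (auto simp: inj_on_def)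
  qed
qed

text \<open>Minimality denies 2-connectedness of subgraphs, so 2-connectedness also has to be pulled
  back along \<open>h\<close>.\<close>

lemma two_connected_image_iff:
  assumes inj: "inj_on h V" and E: "\<And>e. e \<in> E \<Longrightarrow> e \<subseteq> V"
  shows "two_connected (h ` V) ((`) h ` E) \<longleftrightarrow> two_connected V E"
proof
  let ?g = "inv_into V h"
  assume "two_connected (h ` V) ((`) h ` E)"
  then have "two_connected (?g ` h ` V) ((`) ?g ` (`) h ` E)"
    by (rule two_connected_image[rotated]) (rule inj_on_inv_into, simp)
  moreover have g: "?g ` h ` S = S" if "S \<subseteq> V" for S
    using inj that by (auto simp: image_image inv_into_f_f subset_iff image_iff)
  then have "(`) ?g ` (`) h ` E = E" "?g ` h ` V = V"
    using E by (auto simp: image_image image_iff)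
  ultimately show "two_connected V E" by simp
qed (rule two_connected_image[OF inj])

lemma min_two_connected_image:
  assumes inj: "inj_on h V" and min: "min_two_connected V E"
  shows "min_two_connected (h ` V) ((`) h ` E)"
  unfolding min_two_connected_def
proof (intro conjI ballI)
  have G: "simple_graph V E" using min by (simp add: min_two_connected_def)
  have E: "e \<subseteq> V" if "e \<in> E" for e using G that by (simp add: simple_graph_def)
  show "simple_graph (h ` V) ((`) h ` E)"
    unfolding simple_graph_def
  proof (intro conjI ballI)
    fix e assume "e \<in> (`) h ` E"
    then obtain e' where e': "e' \<in> E" "e = h ` e'" by blast
    then show "e \<subseteq> h ` V" using E by blast
    have "inj_on h e'" using inj_on_subset[OF inj E[OF e'(1)]] .
    then show "card e = 2" using e' G by (simp add: card_image simple_graph_def)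
  qed (use G in \<open>simp add: simple_graph_def\<close>)
  show "two_connected (h ` V) ((`) h ` E)"
    using min inj by (intro two_connected_image) (simp_all add: min_two_connected_def)
  fix e assume "e \<in> (`) h ` E"
  then obtain e' where e': "e' \<in> E" "e = h ` e'" by blast
  have "inj_on ((`) h) E" by (rule inj_on_subset[OF inj_on_image_Pow[OF inj]]) (use E in auto)
  then have "(`) h ` E - {e} = (`) h ` (E - {e'})"
    using e' by (simp add: inj_on_image_set_diff[of "(`) h" E])
  then show "\<not> two_connected (h ` V) ((`) h ` E - {e})"
    using two_connected_image_iff[OF inj, of "E - {e'}"] E min e' by (auto simp: min_two_connected_def)
qed

lemma linked_image:
  assumes inj: "inj_on h V" and G: "simple_graph V E" and xy: "x \<in> V" "y \<in> V" "x \<noteq> y"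
    and l: "linked E x y k"
  shows "linked ((`) h ` E) (h x) (h y) k"
proof -
  let ?E = "(`) h ` E"
  obtain F where F: "link_family E x y F" "k \<le> card F + of_bool ({x, y} \<in> E)" "\<And>I. I \<in> F \<Longrightarrow> I \<subseteq> V"
    using linked_in_verts[OF G l xy] by metis
  have hxy: "h x \<noteq> h y" using inj xy by (auto simp: inj_on_def)
  have edge: "{h a, h b} \<in> ?E" if "{a, b} \<in> E" for a b using imageI[OF that, of "(`) h"] by simp
  have link: "link ?E (h x) (h y) (h ` I)" if "I \<in> F" for I
  proof -
    have I: "x \<notin> I" "y \<notin> I" "conn_in (E - {{x, y}}) (insert x (insert y I)) x y" "I \<subseteq> V"
      using F(1) F(3)[OF that] that by (auto simp: link_family_def link_def)
    have "conn_in (?E - {{h x, h y}}) (insert (h x) (insert (h y) (h ` I))) (h x) (h y)"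
      using I(3)
    proof (rule conn_in_map)
      fix a b assume ab: "{a, b} \<in> E - {{x, y}}" "a \<in> insert x (insert y I)" "b \<in> insert x (insert y I)"
      have "a \<in> V" "b \<in> V" using ab(1) simple_graphD(1,2)[OF G] by blast+
      then have "{h a, h b} \<noteq> {h x, h y}" using inj_doubleton[OF inj _ _ xy(1,2), of a b] ab(1) by blast
      then show "conn_in (?E - {{h x, h y}}) (insert (h x) (insert (h y) (h ` I))) (h a) (h b)"
        using ab edge[of a b] by (intro conn_in_edge) auto
    qed
    moreover have "h x \<notin> h ` I" "h y \<notin> h ` I"
      using I(1,2,4) xy inj by (auto simp: inj_on_def)
    ultimately show ?thesis by (simp add: link_def)
  qed
  have disj: "h ` I \<inter> h ` J = {}" if "I \<in> F" "J \<in> F" "I \<noteq> J" for I J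
  proof -
    have "I \<inter> J = {}" using F(1) that by (auto simp: link_family_def pairwise_def disjnt_def)
    then show ?thesis using inj_on_image_Int[OF inj F(3)[OF that(1)] F(3)[OF that(2)]] by simp
  qed
  have "pairwise disjnt F" "finite F" using F(1) by (auto simp: link_family_def)
  then have "link_family ?E (h x) (h y) ((`) h ` F)" "card ((`) h ` F) = card F"
    using link_family_image[OF _ _ hxy link disj] by auto
  moreover have "of_bool ({x, y} \<in> E) \<le> (of_bool ({h x, h y} \<in> ?E) :: nat)" using edge by auto
  ultimately show ?thesis using F(2) linkedI[of ?E "h x" "h y" "(`) h ` F" k] by linarith
qed

section \<open>Optimal graphs\<close>

lemma graph_of_pair_connectivity:
  assumes "simple_graph V E" "x \<in> V" "y \<in> V" "x \<noteq> y"
  shows "k \<le> pair_connectivity (graph_of V E) {x, y} \<longleftrightarrow> linked E x y k"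
  using le_pair_connectivity_iff[OF graph_of_simple(1,2)[OF assms(1)], of x y k]
    graph_of_simple(3)[OF assms(1)] assms by simp

lemma total_connectivity_graph_of:
  assumes "finite_loopless G" "inj_on (ends G) (edges G)"
  shows "total_connectivity G = total_connectivity (graph_of (verts G) (edge_sets G))"
proof -
  note simple = finite_loopless_simple_graph[OF assms(1)]
  note H = graph_of_simple[OF simple]
  have id: "bij_betw (\<lambda>x. x) (verts G) (verts G)" by (simp add: bij_betw_def)
  show ?thesis
    by (intro antisym total_connectivity_le[OF assms H(1,2), of "\<lambda>x. x"]
        total_connectivity_le[OF H(1,2) assms, of "\<lambda>x. x"])
      (use id H(3) in simp_all)
qed

text \<open>Optimality speaks about graphs on natural numbers, so the competitor is copied along
  injections of its vertices and of its edges into \<open>nat\<close>. The vertex \<open>z\<close>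
  bounds the connectivity of the copy by 2.\<close>

lemma optimal_total_connectivity:
  fixes G :: "('v, 'e) multigraph" and V :: "'w set"
  assumes opt: "optimal_minimally_2_connected G" and card: "card V = order G" "order G \<ge> 4"
    and min: "min_two_connected V E"
    and z: "z \<in> V" "p \<in> V" "q \<in> V" "p \<noteq> q" "z \<noteq> p" "z \<noteq> q"
    and nb: "\<And>b. {z, b} \<in> E \<Longrightarrow> b = p \<or> b = q"
  shows "total_connectivity (graph_of V E) \<le> total_connectivity G"
proof -
  have simple: "simple_graph V E" using min by (simp add: min_two_connected_def)
  then have "finite V" by (simp add: simple_graph_def)
  then obtain h :: "'w \<Rightarrow> nat" where h: "inj_on h V" using finite_imp_inj_to_nat_seg by metis
  let ?V = "h ` V" and ?E = "(`) h ` E"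
  have min': "min_two_connected ?V ?E" by (rule min_two_connected_image[OF h min])
  then have simple': "simple_graph ?V ?E" by (simp add: min_two_connected_def)
  obtain \<phi> :: "nat set \<Rightarrow> nat" where \<phi>: "inj_on \<phi> ?E"
    using finite_imp_inj_to_nat_seg[OF simple_graph_finite[OF simple']] by metis
  define H :: "(nat, nat) multigraph" where
    "H = \<lparr>verts = ?V, edges = \<phi> ` ?E, ends = inv_into ?E \<phi>\<rparr>"
  have H: "verts H = ?V" "edges H = \<phi> ` ?E" "ends H = inv_into ?E \<phi>" by (simp_all add: H_def)
  have ends: "ends H (\<phi> e) = e" if "e \<in> ?E" for e unfolding H using \<phi> that by (rule inv_into_f_f)
  have inj: "inj_on (ends H) (edges H)" unfolding H by (rule inj_on_inv_into) simp
  have edge_sets: "edge_sets H = ?E"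
  proof -
    have "edge_sets H = (\<lambda>e. ends H (\<phi> e)) ` ?E" unfolding H(2) by (simp add: image_image)
    also have "\<dots> = (\<lambda>e. e) ` ?E" using ends by (intro image_cong) auto
    finally show ?thesis by simp
  qed
  have fl: "finite_loopless H"
    unfolding finite_loopless_def
  proof (intro conjI ballI)
    fix e assume "e \<in> edges H"
    then have "ends H e \<in> ?E" using edge_sets by blast
    then have "ends H e \<subseteq> ?V \<and> card (ends H e) = 2" using simple' unfolding simple_graph_def by blast
    then show "ends H e \<subseteq> verts H" "card (ends H e) = 2" using H(1) by simp_all
  qed (use simple_graph_finite[OF simple'] \<open>finite V\<close> H in simp_all)
  have ord: "order H = order G" using card(1) h by (simp add: order_def H card_image)
  have hz: "h z \<in> verts H" "h p \<in> verts H" "h q \<in> verts H" "h p \<noteq> h q" "h z \<noteq> h p" "h z \<noteq> h q"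
    using z h by (auto simp: H inj_on_def)
  have "b = h p \<or> b = h q" if b: "{h z, b} \<in> edge_sets H" for b
  proof -
    obtain e where e: "e \<in> E" "{h z, b} = h ` e" using b unfolding edge_sets by blast
    obtain a c where ac: "e = {a, c}" "a \<in> V" "c \<in> V" using simple_graph_edge[OF simple e(1)] by metis
    have "(h z = h a \<and> b = h c) \<or> (h z = h c \<and> b = h a)" using e(2) ac(1) by (auto simp: doubleton_eq_iff)
    then have "(z = a \<and> b = h c) \<or> (z = c \<and> b = h a)" using h z ac by (auto dest: inj_onD)
    then show ?thesis using nb[of a] nb[of c] e(1) ac(1) by (auto simp: insert_commute)
  qed
  then have "minimally_2_connected H"
    using minimally_2_connectedI[OF fl inj _ _ hz] ord card min' H(1) edge_sets by simp
  then have "average_connectivity H \<le> average_connectivity G"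
    using opt ord by (simp add: optimal_minimally_2_connected_def)
  moreover have "order G choose 2 > 0" using card by simp
  ultimately have le: "total_connectivity H \<le> total_connectivity G"
    unfolding average_connectivity_total ord by (simp add: divide_le_cancel)
  have "total_connectivity (graph_of V E) \<le> total_connectivity H"
  proof (rule total_connectivity_le[OF graph_of_simple(1,2)[OF simple] fl inj])
    show "bij_betw h (verts (graph_of V E)) (verts H)" using h by (simp add: bij_betw_def H)
    show "linked (edge_sets H) (h x) (h y) k"
      if "x \<in> verts (graph_of V E)" "y \<in> verts (graph_of V E)" "x \<noteq> y"
        "linked (edge_sets (graph_of V E)) x y k" for x y k
      unfolding edge_sets using linked_image[OF h simple, of x y k] that graph_of_simple(3)[OF simple] by simp
  qed
  then show ?thesis using le by linarith
qed

lemma sum_pairs_insert: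
  assumes "finite W" "u \<notin> W"
  shows "(\<Sum>S\<in>pairs (insert u W). f S) = (\<Sum>x\<in>W. f {u, x}) + (\<Sum>S\<in>pairs W. f S)"
proof -
  have eq: "pairs (insert u W) = (\<lambda>x. {u, x}) ` W \<union> pairs W"
  proof (intro equalityI subsetI)
    fix S assume "S \<in> pairs (insert u W)"
    then obtain x y where S: "S = {x, y}" "x \<noteq> y" "x \<in> insert u W" "y \<in> insert u W" by (rule pairs_E)
    then show "S \<in> (\<lambda>x. {u, x}) ` W \<union> pairs W" by (auto simp: pairs_def insert_commute)
  next
    fix S assume "S \<in> (\<lambda>x. {u, x}) ` W \<union> pairs W"
    then consider x where "S = {u, x}" "x \<in> W" | "S \<in> pairs W" by blast
    then show "S \<in> pairs (insert u W)"
    proof cases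
      case (1 x)
      then have "u \<noteq> x" using assms(2) by blast
      then show ?thesis using 1 by (simp add: pairs_def)
    qed (auto simp: pairs_def)
  qed
  have "inj_on (\<lambda>x. {u, x}) W" by (auto simp: inj_on_def doubleton_eq_iff)
  then have "(\<Sum>S\<in>(\<lambda>x. {u, x}) ` W. f S) = (\<Sum>x\<in>W. f {u, x})" by (simp add: sum.reindex)
  moreover have "(\<lambda>x. {u, x}) ` W \<inter> pairs W = {}" using assms(2) by (auto simp: pairs_def)
  ultimately show ?thesis
    unfolding eq using assms(1) by (subst sum.union_disjoint) (simp_all add: finite_pairs)
qed

text \<open>The bound \<open>k \<ge> 3\<close> excludes that \<open>p\<close> and \<open>q\<close>
  lie on different sides of the cut, so one of the two sides together with \<open>c\<close> contains
  both.\<close>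

lemma (in edge_cut) linked_contract:
  assumes "p \<in> V - {u, v}" "q \<in> V - {u, v}" "p \<noteq> q" "linked E p q k" "k \<ge> 3"
  shows "linked (contract u v u E) p q k"
proof -
  interpret s: edge_cut V E v u c B A by (rule swap)
  have l3: "linked E p q 3" using linked_mono[OF assms(4,5)] .
  have "\<not> (p \<in> A \<and> q \<in> B)" using not_linked_across[of p q] l3 by blast
  moreover have "\<not> (p \<in> B \<and> q \<in> A)" using s.not_linked_across[of p q] l3 by blast
  ultimately consider "p \<in> insert c A - {u}" "q \<in> insert c A - {u}"
    | "p \<in> insert c B - {v}" "q \<in> insert c B - {v}"
    using assms(1,2) V(1) by blast
  then show ?thesis
  proof cases
    case 1
    then show ?thesis using linked_same_side[of u p q k] assms by blast
  next
    case 2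
    then show ?thesis using s.linked_same_side[of u p q k] assms contract_commute[of u v u E] by simp
  qed
qed

lemma (in edge_cut) total_connectivity_contract:
  assumes min: "\<And>e. e \<in> E \<Longrightarrow> \<not> two_connected V (E - {e})" and card: "card V \<ge> 4"
  shows "total_connectivity (graph_of V E) \<le>
    total_connectivity (graph_of (V - {v}) (contract u v u E)) + 2 * (card V - 1)"
proof -
  interpret s: edge_cut V E v u c B A by (rule swap)
  let ?C = "contract u v u E" and ?W = "V - {u, v}"
  define f g where "f = pair_connectivity (graph_of V E)"
    and "g = pair_connectivity (graph_of (V - {v}) ?C)"
  have fin: "finite V" using G by (simp add: simple_graph_def)
  have simple: "simple_graph (V - {v}) ?C" using simple_graph_contract[OF G(1)] distinct by blast
  have card': "card (V - {v}) \<ge> 3" using card fin distinct by simp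
  have f: "k \<le> f {x, y} \<longleftrightarrow> linked E x y k" if "x \<in> V" "y \<in> V" "x \<noteq> y" for x y k
    unfolding f_def using graph_of_pair_connectivity[OF G(1) that] .
  have g: "k \<le> g {x, y} \<longleftrightarrow> linked ?C x y k" if "x \<in> V - {v}" "y \<in> V - {v}" "x \<noteq> y" for x y k
    unfolding g_def using graph_of_pair_connectivity[OF simple that] .
  have g2: "2 \<le> g {x, y}" if "x \<in> V - {v}" "y \<in> V - {v}" "x \<noteq> y" for x y
    unfolding g[OF that] using two_connected_linked[OF simple two_connected_contract card' that] .
  have G': "min_two_connected V E" using G min by (simp add: min_two_connected_def)
  have tri: "{u, x} \<notin> E \<or> {v, x} \<notin> E" for x
    using min_two_connected_triangle_free[OF G' card uv(3)] by blast
  have fu: "f {u, x} \<le> g {u, x}" "f {v, x} \<le> g {u, x}" if x: "x \<in> ?W" for x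
  proof -
    have xV: "x \<in> V" "u \<noteq> x" "v \<noteq> x" "x \<noteq> u" "x \<noteq> v" using x by auto
    have "linked E u x (f {u, x})" "linked E v x (f {v, x})" using f distinct xV by blast+
    then have "linked ?C u x (f {u, x})" "linked ?C u x (f {v, x})"
      using linked_merge[of u u v x E] linked_merge[of u v u x E] tri[of x] xV distinct
        contract_commute[of u v u E] by (auto simp: disj_commute)
    then show "f {u, x} \<le> g {u, x}" "f {v, x} \<le> g {u, x}" using g[of u x] xV distinct by simp_all
  qed
  \<comment> \<open>For \<open>x\<close> in \<open>A\<close> the value at \<open>vx\<close> is at
    most 2, for \<open>x\<close> in \<open>B\<close> the value at \<open>ux\<close>; the other value
    does not drop by \<open>fu\<close>. At \<open>c\<close> neither need be small, and the links on
    the two sides are added.\<close>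
  have star: "f {u, x} + f {v, x} \<le> g {u, x} + 2" if x: "x \<in> ?W" for x
  proof -
    have xV: "x \<in> V" "u \<noteq> x" "v \<noteq> x" "x \<noteq> u" "x \<noteq> v" using x by auto
    consider "x \<in> A" | "x \<in> B" | "x = c" using xV(1) V(1) by blast
    then show ?thesis
    proof cases
      case 1
      then have "\<not> 3 \<le> f {v, x}" using s.not_linked_across[OF s.uv(1)] f[of v x 3] xV distinct by blast
      then show ?thesis using fu[OF x] by linarith
    next
      case 2
      then have "\<not> 3 \<le> f {u, x}" using not_linked_across[OF uv(1)] f[of u x 3] xV distinct by blast
      then show ?thesis using fu[OF x] by linarith
    next
      case 3
      have "linked E u c (f {u, c})" "linked E v c (f {v, c})" using f distinct by blast+
      then have "linked ?C u c (f {u, c} + f {v, c} - 2)"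
        using linked_merge_cut[of u] tri[of c] by blast
      then have "f {u, c} + f {v, c} - 2 \<le> g {u, c}" using g[of u c] distinct by simp
      then show ?thesis unfolding 3 by linarith
    qed
  qed
  \<comment> \<open>Values of at least 3 are preserved by contraction; smaller ones are covered by
    Whitney's theorem in the form \<open>g2\<close>.\<close>
  have rest: "f S \<le> g S" if S: "S \<in> pairs ?W" for S
  proof -
    obtain p q where pq: "S = {p, q}" "p \<noteq> q" "p \<in> ?W" "q \<in> ?W" using S by (rule pairs_E)
    show ?thesis
    proof (cases "f S \<ge> 3")
      case True
      have "linked E p q (f S)" using f[of p q "f S"] pq by simp
      then have "linked ?C p q (f S)" using linked_contract[OF pq(3,4,2)] True by blast
      then show ?thesis using g[of p q] pq by simp
    next
      case False
      then show ?thesis using g2[of p q] pq by simp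
    qed
  qed
  have fuv: "f {u, v} \<le> 2" using not_linked_across[OF uv(1,2)] f[of u v 3] distinct by linarith
  have V_eq: "V = insert u (insert v ?W)" "V - {v} = insert u ?W" using distinct by auto
  have cardW: "card V - 1 = Suc (card ?W)" using fin distinct card by (simp add: card_Diff_subset)
  have "total_connectivity (graph_of V E) = (\<Sum>S\<in>pairs (insert u (insert v ?W)). f S)"
    unfolding total_connectivity_def f_def using V_eq(1) by simp
  also have "\<dots> = (\<Sum>x\<in>insert v ?W. f {u, x}) + ((\<Sum>x\<in>?W. f {v, x}) + (\<Sum>S\<in>pairs ?W. f S))"
    using fin distinct by (subst sum_pairs_insert; simp add: sum_pairs_insert)
  also have "\<dots> = f {u, v} + (\<Sum>x\<in>?W. f {u, x} + f {v, x}) + (\<Sum>S\<in>pairs ?W. f S)"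
    using fin by (simp add: sum.distrib)
  also have "\<dots> \<le> 2 + (\<Sum>x\<in>?W. g {u, x} + 2) + (\<Sum>S\<in>pairs ?W. g S)"
    by (rule add_mono[OF add_mono[OF fuv sum_mono[OF star]] sum_mono[OF rest]])
  also have "\<dots> = (\<Sum>x\<in>?W. g {u, x}) + (\<Sum>S\<in>pairs ?W. g S) + 2 * (card V - 1)"
    unfolding sum.distrib cardW by simp
  also have "(\<Sum>x\<in>?W. g {u, x}) + (\<Sum>S\<in>pairs ?W. g S) = (\<Sum>S\<in>pairs (insert u ?W). g S)"
    using fin by (subst sum_pairs_insert) auto
  also have "\<dots> = total_connectivity (graph_of (V - {v}) ?C)"
    unfolding total_connectivity_def g_def using V_eq(2) by simp
  finally show ?thesis by simp
qed

text \<open>There are \<open>card V\<close> pairs containing \<open>z\<close>, each of value at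
  least 2 by Whitney's theorem. Strictness comes from the pair \<open>pq\<close>, which gains the
  link \<open>{z}\<close>.\<close>

lemma (in ear_extension) total_connectivity_ear:
  "total_connectivity (graph_of V E) + 2 * card V <
    total_connectivity (graph_of (insert z V) (ear p q z E))"
proof -
  let ?E = "ear p q z E"
  define f g where "f = pair_connectivity (graph_of V E)"
    and "g = pair_connectivity (graph_of (insert z V) ?E)"
  have fin: "finite V" using G by (simp add: simple_graph_def)
  have f: "k \<le> f {x, y} \<longleftrightarrow> linked E x y k" if "x \<in> V" "y \<in> V" "x \<noteq> y" for x y k
    unfolding f_def using graph_of_pair_connectivity[OF G(1) that] .
  have g: "k \<le> g {x, y} \<longleftrightarrow> linked ?E x y k" if "x \<in> insert z V" "y \<in> insert z V" "x \<noteq> y" for x y k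
    unfolding g_def using graph_of_pair_connectivity[OF simple_graph_ear that] .
  have card': "card (insert z V) \<ge> 3" using card_V fin z by simp
  have star: "2 \<le> g {z, x}" if "x \<in> V" for x
  proof -
    have "z \<noteq> x" using that z by blast
    then show ?thesis
      using g[of z x 2] two_connected_linked[OF simple_graph_ear two_connected_ear card', of z x] that by simp
  qed
  have mono: "f S \<le> g S" if S: "S \<in> pairs V" for S
  proof -
    obtain x y where xy: "S = {x, y}" "x \<noteq> y" "x \<in> V" "y \<in> V" using S by (rule pairs_E)
    have "linked E x y (f S)" using f[of x y "f S"] xy by simp
    then show ?thesis using linked_ear g[of x y] xy by simp
  qed
  have "f {p, q} < g {p, q}"
  proof -
    have "linked E p q (f {p, q})" using f[of p q "f {p, q}"] pq by simp
    then have "linked ?E p q (Suc (f {p, q}))" by (rule linked_ear_ends)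
    then show ?thesis using g[of p q "Suc (f {p, q})"] pq by simp
  qed
  moreover have "{p, q} \<in> pairs V" using pq by (simp add: pairs_def)
  ultimately have "(\<Sum>S\<in>pairs V. f S) < (\<Sum>S\<in>pairs V. g S)"
    using mono finite_pairs[OF fin] by (intro sum_strict_mono_ex1) auto
  moreover have "(\<Sum>x\<in>V. 2) \<le> (\<Sum>x\<in>V. g {z, x})" using star by (intro sum_mono) auto
  moreover have "(\<Sum>S\<in>pairs (insert z V). g S) = (\<Sum>x\<in>V. g {z, x}) + (\<Sum>S\<in>pairs V. g S)"
    by (rule sum_pairs_insert[OF fin z])
  ultimately show ?thesis unfolding total_connectivity_def f_def[symmetric] g_def[symmetric] by simp
qed

text \<open>Otherwise no pair exceeds 2. In K(2, n - 2) no pair is below 2, and the two hubs reach n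
  - 2, which is at least 3 because \<open>order G \<ge> 5\<close>.\<close>

lemma optimal_linked_three:
  fixes G :: "('v, 'e) multigraph"
  assumes opt: "optimal_minimally_2_connected G" and n: "order G \<ge> 5"
  shows "\<exists>p q. p \<in> verts G \<and> q \<in> verts G \<and> p \<noteq> q \<and> linked (edge_sets G) p q 3"
proof (rule ccontr)
  assume "\<not> ?thesis"
  then have none: "\<not> linked (edge_sets G) p q 3" if "p \<in> verts G" "q \<in> verts G" "p \<noteq> q" for p q
    using that by blast
  have m2c: "minimally_2_connected G" using opt by (simp add: optimal_minimally_2_connected_def)
  have "order G \<ge> 3" using n by simp
  note G = minimally_2_connectedD[OF m2c this]
  have fin: "finite (verts G)" using G(1) by (simp add: finite_loopless_def)
  obtain a where a: "a \<in> verts G" using n by (force simp: order_def)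
  obtain b where b: "b \<in> verts G" "b \<noteq> a" using third_vertex[OF fin, of a a] n by (auto simp: order_def)
  define W where "W = verts G - {a, b}"
  have V: "verts G = insert a (insert b W)" "a \<notin> W" "b \<notin> W" "finite W" using a b fin by (auto simp: W_def)
  have cardW: "card W \<ge> 3" using n V b by (simp add: order_def)
  then obtain z where z: "z \<in> W" by fastforce
  let ?E = "two_hub W a b"
  have ab: "a \<noteq> b" using b by blast
  have W2: "card W \<ge> 2" using cardW by simp
  note hub = two_hub[OF V(4) W2 V(2,3) ab]
  have min: "min_two_connected (verts G) ?E" using hub(1) V(1) by simp
  then have simple: "simple_graph (verts G) ?E" "two_connected (verts G) ?E" by (simp_all add: min_two_connected_def)
  have le: "total_connectivity (graph_of (verts G) ?E) \<le> total_connectivity G"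
  proof (rule optimal_total_connectivity[OF opt _ _ min, of z a b])
    show "x = a \<or> x = b" if "{z, x} \<in> ?E" for x using hub(3)[OF z that] .
  qed (use z V ab n in \<open>auto simp: order_def\<close>)
  let ?g = "pair_connectivity (graph_of (verts G) ?E)"
  have g: "k \<le> ?g {x, y} \<longleftrightarrow> linked ?E x y k" if "x \<in> verts G" "y \<in> verts G" "x \<noteq> y" for x y k
    using graph_of_pair_connectivity[OF simple(1) that] .
  have card3: "card (verts G) \<ge> 3" using n by (simp add: order_def)
  have "pair_connectivity G S \<le> ?g S" if S: "S \<in> pairs (verts G)" for S
  proof -
    obtain x y where xy: "S = {x, y}" "x \<noteq> y" "x \<in> verts G" "y \<in> verts G" using S by (rule pairs_E)
    have "\<not> 3 \<le> pair_connectivity G S"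
      using le_pair_connectivity_iff[OF G(1,2) xy(3,4,2)] none[OF xy(3,4,2)] xy(1) by simp
    moreover have "2 \<le> ?g S"
      using g[OF xy(3,4,2)] two_connected_linked[OF simple card3 xy(3,4,2)] xy(1) by simp
    ultimately show ?thesis by linarith
  qed
  moreover have "pair_connectivity G {a, b} < ?g {a, b}"
  proof -
    have "\<not> 3 \<le> pair_connectivity G {a, b}"
      using le_pair_connectivity_iff[OF G(1,2) a b(1) ab] none[OF a b(1) ab] by simp
    moreover have "3 \<le> ?g {a, b}" using g[OF a b(1) ab] linked_mono[OF hub(2) cardW] by simp
    ultimately show ?thesis by linarith
  qed
  moreover have "{a, b} \<in> pairs (verts G)" using a b ab by (simp add: pairs_def)
  ultimately have "total_connectivity G < total_connectivity (graph_of (verts G) ?E)"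
    unfolding total_connectivity_def graph_of_simps
    using finite_pairs[OF fin] by (intro sum_strict_mono_ex1) auto
  then show False using le by simp
qed

lemma degree_incident:
  assumes "inj_on (ends G) (edges G)"
  shows "degree G v = card (incident (edge_sets G) v)"
proof -
  have "incident (edge_sets G) v = ends G ` {e \<in> edges G. v \<in> ends G e}" by (auto simp: incident_def)
  moreover have "inj_on (ends G) {e \<in> edges G. v \<in> ends G e}" using assms by (rule inj_on_subset) auto
  ultimately show ?thesis by (simp add: degree_def card_image)
qed

text \<open>A neighbour \<open>b\<close> exists, and as \<open>b\<close> is no cut vertex, there is
  a second one.\<close>

lemma two_connected_degree:
  assumes G: "simple_graph V E" "two_connected V E" "card V \<ge> 3" and x: "x \<in> V"
  shows "2 \<le> card (incident E x)"
proof -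
  have fin: "finite V" using G by (simp add: simple_graph_def)
  obtain d where d: "d \<in> V" "d \<noteq> x" using third_vertex[OF fin G(3), of x x] by auto
  obtain b where b: "{x, b} \<in> E" "b \<noteq> d" "b \<noteq> x" using two_connected_neighbour[OF G(2) fin G(3) x d] .
  have bV: "b \<in> V" using simple_graphD(2)[OF G(1) b(1)] .
  obtain b' where b': "{x, b'} \<in> E" "b' \<noteq> b" "b' \<noteq> x"
    using two_connected_neighbour[OF G(2) fin G(3) x bV b(3)] .
  have "{{x, b}, {x, b'}} \<subseteq> incident E x" using b b' by (simp add: incident_def)
  moreover have "finite (incident E x)" using simple_graph_finite[OF G(1)] by (simp add: incident_def)
  ultimately have "card {{x, b}, {x, b'}} \<le> card (incident E x)" by (intro card_mono)
  moreover have "{x, b} \<noteq> {x, b'}" using b' by (auto simp: doubleton_eq_iff)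
  ultimately show ?thesis by simp
qed

lemma optimal_edge_degrees:
  fixes G :: "('v, 'e) multigraph"
  assumes opt: "optimal_minimally_2_connected G" and n: "order G \<ge> 5" and uv: "{u, v} \<in> edge_sets G"
  shows "\<not> ((degree G u \<ge> 3 \<and> degree G v \<ge> 3) \<or> (degree G u = 2 \<and> degree G v = 2))"
proof
  assume deg: "(degree G u \<ge> 3 \<and> degree G v \<ge> 3) \<or> (degree G u = 2 \<and> degree G v = 2)"
  have m2c: "minimally_2_connected G" using opt by (simp add: optimal_minimally_2_connected_def)
  have "order G \<ge> 3" using n by simp
  note wf = minimally_2_connectedD[OF m2c this]
  define V E where "V = verts G" and "E = edge_sets G"
  have min: "simple_graph V E" "two_connected V E" "\<And>e. e \<in> E \<Longrightarrow> \<not> two_connected V (E - {e})"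
    using wf(3) by (auto simp: min_two_connected_def V_def E_def)
  have fin: "finite V" using min(1) by (simp add: simple_graph_def)
  have cardV: "card V \<ge> 5" "card V = order G" using n by (simp_all add: V_def order_def)
  have uvE: "{u, v} \<in> E" using uv by (simp add: E_def)
  obtain c A B where "edge_cut V E u v c A B"
    using edge_cut_exists[OF min(1,2) uvE min(3)[OF uvE]] .
  then interpret edge_cut V E u v c A B .
  interpret s: edge_cut V E v u c B A by (rule swap)
  let ?C = "contract u v u E"
  have card4: "card V \<ge> 4" using cardV by simp
  have minC: "min_two_connected (V - {v}) ?C"
    using min_two_connected_contract[OF min(3) card4] deg degree_incident[OF wf(2)] by (simp add: E_def)
  have le: "total_connectivity (graph_of V E) \<le> total_connectivity (graph_of (V - {v}) ?C) + 2 * (card V - 1)"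
    by (rule total_connectivity_contract[OF min(3) card4])
  have tri: "{u, x} \<notin> E \<or> {v, x} \<notin> E" for x
    using min_two_connected_triangle_free[of V E u v x] wf(3) card4 uvE by (auto simp: V_def E_def)
  obtain p q where pq: "p \<in> V" "q \<in> V" "p \<noteq> q" "linked E p q 3"
    using optimal_linked_three[OF opt n] by (auto simp: V_def E_def)
  have hub: "linked ?C u x 3" if x: "x \<in> V - {u, v}" and l: "linked E u x 3 \<or> linked E v x 3" for x
    using l linked_merge[of u u v x E 3] linked_merge[of u v u x E 3] tri[of x] x distinct
      contract_commute[of u v u E] by auto
  have "\<exists>p q. p \<in> V - {v} \<and> q \<in> V - {v} \<and> p \<noteq> q \<and> linked ?C p q 3"
  proof -
    \<comment> \<open>At most one of \<open>p\<close> and \<open>q\<close> is an end of the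
      contracted edge, so their images in the contraction are distinct.\<close>
    have "\<not> linked E u v 3" "\<not> linked E v u 3"
      using not_linked_across[OF uv(1,2)] s.not_linked_across[OF s.uv(1,2)] by auto
    then consider "p \<in> V - {u, v}" "q \<in> V - {u, v}" | "p = u \<or> p = v" "q \<in> V - {u, v}"
      | "q = u \<or> q = v" "p \<in> V - {u, v}"
      using pq by auto
    then show ?thesis
    proof cases
      case 1
      then show ?thesis using linked_contract[OF 1 pq(3,4)] pq by blast
    next
      case 2
      then show ?thesis using hub[of q] pq(4) distinct by (intro exI[of _ u] exI[of _ q]) auto
    next
      case 3
      then show ?thesis using hub[of p] linked_sym[OF pq(4)] distinct
        by (intro exI[of _ u] exI[of _ p]) auto
    qed
  qed
  then obtain p' q' where pq': "p' \<in> V - {v}" "q' \<in> V - {v}" "p' \<noteq> q'" "linked ?C p' q' 3" by blast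
  have card': "card (V - {v}) = card V - 1" using fin distinct by simp
  \<comment> \<open>Contraction to \<open>u\<close> has freed the name \<open>v\<close>, which is
    reused for the new vertex; the resulting graph has vertex set \<open>V\<close> again.\<close>
  interpret ear: ear_extension "V - {v}" ?C p' q' v
    by unfold_locales (use minC pq' card' cardV in auto)
  let ?H = "ear p' q' v ?C"
  have V_eq: "insert v (V - {v}) = V" using distinct by auto
  have "total_connectivity (graph_of V ?H) \<le> total_connectivity G"
  proof (rule optimal_total_connectivity[OF opt, of V ?H v p' q'])
    show "min_two_connected V ?H" using ear.min_two_connected_ear V_eq by simp
    show "b = p' \<or> b = q'" if "{v, b} \<in> ?H" for b using ear.z_edges(1)[OF that] .
  qed (use cardV n pq' distinct in auto)
  moreover have "total_connectivity G = total_connectivity (graph_of V E)"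
    unfolding V_def E_def by (rule total_connectivity_graph_of[OF wf(1,2)])
  moreover have "total_connectivity (graph_of (V - {v}) ?C) + 2 * (card V - 1) < total_connectivity (graph_of V ?H)"
    using ear.total_connectivity_ear card' V_eq by simp
  ultimately show False using le by linarith
qed

theorem theorem2p6:
  fixes G :: "('v, 'e) multigraph"
  assumes "optimal_minimally_2_connected G" and "order G \<ge> 5"
  shows "bipartite_with_parts G {v \<in> verts G. degree G v = 2} {v \<in> verts G. degree G v > 2}"
  unfolding bipartite_with_parts_def
proof (intro conjI ballI)
  let ?A = "{v \<in> verts G. degree G v = 2}" and ?B = "{v \<in> verts G. degree G v > 2}"
  have m2c: "minimally_2_connected G" using assms(1) by (simp add: optimal_minimally_2_connected_def)
  have n: "order G \<ge> 3" using assms(2) by simp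
  note G = minimally_2_connectedD[OF m2c n]
  have simple: "simple_graph (verts G) (edge_sets G)" "two_connected (verts G) (edge_sets G)"
    using G(3) by (simp_all add: min_two_connected_def)
  have deg: "2 \<le> degree G v" if "v \<in> verts G" for v
    unfolding degree_incident[OF G(2)]
    using two_connected_degree[OF simple _ that] n by (simp add: order_def)
  show "?A \<union> ?B = verts G" using deg by (auto simp: le_less)
  show "?A \<inter> ?B = {}" by auto
  fix e assume "e \<in> edges G"
  then have e: "ends G e \<in> edge_sets G" by blast
  obtain u v where uv: "ends G e = {u, v}" "u \<in> verts G" "v \<in> verts G"
    using simple_graph_edge[OF simple(1) e] .
  have "\<not> ((degree G u \<ge> 3 \<and> degree G v \<ge> 3) \<or> (degree G u = 2 \<and> degree G v = 2))"
    using optimal_edge_degrees[OF assms] e uv(1) by metis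
  then have "(u \<in> ?A \<and> v \<in> ?B) \<or> (v \<in> ?A \<and> u \<in> ?B)"
    using deg[OF uv(2)] deg[OF uv(3)] uv(2,3) by auto
  then show "\<exists>a\<in>?A. \<exists>b\<in>?B. ends G e = {a, b}"
  proof
    assume "u \<in> ?A \<and> v \<in> ?B"
    then show ?thesis using uv(1) by blast
  next
    assume "v \<in> ?A \<and> u \<in> ?B"
    moreover have "ends G e = {v, u}" using uv(1) by (simp add: insert_commute)
    ultimately show ?thesis by blast
  qed
qed

end
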